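(* Let $\Omega\subset\mathbb{R}^d$ be a nonempty, bounded, uniform domain, let $0<s<1$, $1\le p<\infty$ and $0<\theta\le 1$. Suppose that $0\le\alpha,\beta<\underline{\mathrm{co\,dim}}_A(\partial\Omega)$. Then the full seminorm $[f]_{W^{s,p;\,\alpha,\beta}(\Omega)}$ and the truncated seminorm $$\left(\int_{\Omega}\int_{B(x,\theta d_{\Omega}(x))}\frac{|f(x)-f(y)|^{p}}{|x-y|^{d+sp}}\,d_\Omega(y)^{-\beta}d_\Omega(x)^{-\alpha}\,dy\,dx\right)^{1/p}$$ are comparable, that is, there exists a constant $C=C(\theta,d,s,p,\alpha,\beta,\Omega)>0$ such that $$\int_{\Omega}\int_{\Omega}\frac{|f(x)-f(y)|^{p}}{|x-y|^{d+sp}}\frac{dy}{d_\Omega(y)^{\beta}}\frac{dx}{d_\Omega(x)^{\alpha}}\le C\int_{\Omega}\int_{B(x,\theta d_{\Omega}(x))}\frac{|f(x)-f(y)|^{p}}{|x-y|^{d+sp}}\frac{dy}{d_\Omega(y)^{\beta}}\frac{dx}{d_\Omega(x)^{\alpha}}$$ for all $f\in L^{1}_{loc}(\Omega)$.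
   Context: Notation: $d_\Omega(x)=\mathrm{dist}(x,\partial\Omega)$. The weighted Gagliardo seminorm is $[f]_{W^{s,p;\,\alpha,\beta}(\Omega)}=\left(\int_\Omega\int_\Omega\frac{|f(x)-f(y)|^p}{|x-y|^{d+sp}}d_\Omega(y)^{-\beta}d_\Omega(x)^{-\alpha}\,dy\,dx\right)^{1/p}$ (the value is unchanged if $\alpha$ and $\beta$ are interchanged, by symmetry in $x,y$); the value $\infty$ is allowed. Uniform domain: a domain (connected open set) $\Omega\subset\mathbb{R}^d$ is uniform if there is a constant $C\ge1$ such that all $x,y\in\Omega$ can be joined by a curve $\gamma:[0,l]\to\Omega$, parameterized by arc length, with $l\le C|x-y|$ and $\mathrm{dist}(z,\partial\Omega)\ge\frac1C\min\{|z-x|,|z-y|\}$ for all $z\in\gamma$. Lower Assouad codimension: for $E\subset\mathbb{R}^d$ and $r>0$ let $\widetilde E_r=\{x\in\mathbb{R}^d:\mathrm{dist}(x,E)\le r\}$. Then $\underline{\mathrm{co\,dim}}_A(E)$ is the supremum of all $q\ge0$ for which there is a constant $C=C(q)\ge1$ such that $|\widetilde E_r\cap B(x,R)|\le C|B(x,R)|(r/R)^q$ for all $x\in E$ and $0<r<R<\mathrm{diam}\,E$. *)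

theory Defs
  imports "HOL-Analysis.Analysis"
begin

text \<open>Euclidean space of dimension \<open>d\<close> is a type \<open>'a :: euclidean_space\<close> with \<open>DIM('a) = d\<close>.\<close>

abbreviation bdist :: "'a::euclidean_space set \<Rightarrow> 'a \<Rightarrow> real" where
  "bdist \<Omega> x \<equiv> infdist x (frontier \<Omega>)"

text \<open>Length of the restriction of \<open>\<gamma>\<close> to \<open>[a, b]\<close>: the supremum of the lengths of
  inscribed polygons, over all finite monotone sequences \<open>t 0 \<le> \<dots> \<le> t n\<close> in \<open>[a, b]\<close>.\<close>

definition curve_length :: "(real \<Rightarrow> 'a::metric_space) \<Rightarrow> real \<Rightarrow> real \<Rightarrow> ennreal" where
  "curve_length \<gamma> a b =
     (SUP (n, t) \<in> {(n :: nat, t :: nat \<Rightarrow> real). t ` {..n} \<subseteq> {a..b} \<and> mono_on {..n} t}.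
        ennreal (\<Sum>i<n. dist (\<gamma> (t i)) (\<gamma> (t (Suc i)))))"

definition arc_length_param :: "(real \<Rightarrow> 'a::metric_space) \<Rightarrow> real \<Rightarrow> bool" where
  "arc_length_param \<gamma> l \<longleftrightarrow> 0 \<le> l \<and> continuous_on {0..l} \<gamma> \<and>
     (\<forall>a b. 0 \<le> a \<and> a \<le> b \<and> b \<le> l \<longrightarrow> curve_length \<gamma> a b = ennreal (b - a))"

text \<open>For \<open>\<Omega> = UNIV\<close> the frontier is empty and \<open>infdist\<close> is \<open>0\<close> rather than \<open>\<infinity>\<close>;
  for nonempty bounded \<open>\<Omega>\<close> the frontier is nonempty.\<close>

definition uniform_domain :: "'a::euclidean_space set \<Rightarrow> bool" where
  "uniform_domain \<Omega> \<longleftrightarrow> open \<Omega> \<and> connected \<Omega> \<and>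
     (\<exists>C\<ge>1. \<forall>x\<in>\<Omega>. \<forall>y\<in>\<Omega>. \<exists>\<gamma> l.
        arc_length_param \<gamma> l \<and> \<gamma> ` {0..l} \<subseteq> \<Omega> \<and> \<gamma> 0 = x \<and> \<gamma> l = y \<and>
        l \<le> C * dist x y \<and>
        (\<forall>z \<in> \<gamma> ` {0..l}. bdist \<Omega> z \<ge> 1 / C * min (dist z x) (dist z y)))"

definition closed_nbhd :: "'a::euclidean_space set \<Rightarrow> real \<Rightarrow> 'a set" where
  "closed_nbhd E r = {x. infdist x E \<le> r}"

text \<open>\<open>diameter\<close> is real-valued and only meaningful for bounded sets; for unbounded \<open>E\<close>
  there is no upper restriction on \<open>R\<close>. The supremum is taken in \<open>ereal\<close>, so it is \<open>\<infinity>\<close>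
  when the exponents are unbounded.\<close>

definition lower_assouad_codim :: "'a::euclidean_space set \<Rightarrow> ereal" where
  "lower_assouad_codim E =
     Sup (ereal ` {q. 0 \<le> q \<and>
       (\<exists>C\<ge>1. \<forall>x\<in>E. \<forall>r R. 0 < r \<and> r < R \<and> (bounded E \<longrightarrow> R < diameter E) \<longrightarrow>
          measure lebesgue (closed_nbhd E r \<inter> ball x R)
            \<le> C * measure lebesgue (ball x R) * (r / R) powr q)})"

definition L1_loc :: "'a::euclidean_space set \<Rightarrow> ('a \<Rightarrow> real) \<Rightarrow> bool" where
  "L1_loc \<Omega> f \<longleftrightarrow> (\<forall>K. compact K \<and> K \<subseteq> \<Omega> \<longrightarrow> f absolutely_integrable_on K)"

definition gagliardo_kernel ::
  "'a::euclidean_space set \<Rightarrow> real \<Rightarrow> real \<Rightarrow> real \<Rightarrow> real \<Rightarrow> ('a \<Rightarrow> real) \<Rightarrow> 'a \<Rightarrow> 'a \<Rightarrow> real" where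
  "gagliardo_kernel \<Omega> s p \<alpha> \<beta> f x y =
     \<bar>f x - f y\<bar> powr p / dist x y powr (real DIM('a) + s * p)
       * bdist \<Omega> y powr (- \<beta>) * bdist \<Omega> x powr (- \<alpha>)"

text \<open>The \<open>p\<close>-th powers of the full and the truncated seminorm; the value \<open>\<infinity>\<close> is allowed.\<close>

definition gagliardo_full ::
  "'a::euclidean_space set \<Rightarrow> real \<Rightarrow> real \<Rightarrow> real \<Rightarrow> real \<Rightarrow> ('a \<Rightarrow> real) \<Rightarrow> ennreal" where
  "gagliardo_full \<Omega> s p \<alpha> \<beta> f =
     (\<integral>\<^sup>+x\<in>\<Omega>. (\<integral>\<^sup>+y\<in>\<Omega>. ennreal (gagliardo_kernel \<Omega> s p \<alpha> \<beta> f x y) \<partial>lebesgue) \<partial>lebesgue)"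

definition gagliardo_truncated ::
  "'a::euclidean_space set \<Rightarrow> real \<Rightarrow> real \<Rightarrow> real \<Rightarrow> real \<Rightarrow> real \<Rightarrow> ('a \<Rightarrow> real) \<Rightarrow> ennreal" where
  "gagliardo_truncated \<Omega> \<theta> s p \<alpha> \<beta> f =
     (\<integral>\<^sup>+x\<in>\<Omega>. (\<integral>\<^sup>+y\<in>ball x (\<theta> * bdist \<Omega> x).
        ennreal (gagliardo_kernel \<Omega> s p \<alpha> \<beta> f x y) \<partial>lebesgue) \<partial>lebesgue)"

lemma ball_bdist_subset:
  fixes \<Omega> :: "'a::euclidean_space set"
  assumes "x \<in> \<Omega>" "\<theta> \<le> 1"
  shows "ball x (\<theta> * bdist \<Omega> x) \<subseteq> \<Omega>"
proof (rule ccontr)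
  assume "\<not> ?thesis"
  then obtain y where y: "y \<in> ball x (\<theta> * bdist \<Omega> x)" "y \<notin> \<Omega>" by blast
  have "0 < \<theta> * bdist \<Omega> x" using y(1) by (metis ball_empty empty_iff not_le)
  then have "x \<in> ball x (\<theta> * bdist \<Omega> x)" by simp
  then have "ball x (\<theta> * bdist \<Omega> x) \<inter> frontier \<Omega> \<noteq> {}"
    using y assms(1) by (intro connected_Int_frontier) (blast intro: convex_connected convex_ball)+
  then obtain z where z: "dist x z < \<theta> * bdist \<Omega> x" "z \<in> frontier \<Omega>" by auto
  have "bdist \<Omega> x \<le> dist x z" using z(2) by (rule infdist_le)
  moreover have "\<theta> * bdist \<Omega> x \<le> 1 * bdist \<Omega> x"
    using assms(2) by (intro mult_right_mono infdist_nonneg)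
  ultimately show False using z(1) by simp
qed

text \<open>The elementary half of the comparability.\<close>

lemma gagliardo_truncated_le_full:
  fixes \<Omega> :: "'a::euclidean_space set"
  assumes "\<theta> \<le> 1"
  shows "gagliardo_truncated \<Omega> \<theta> s p \<alpha> \<beta> f \<le> gagliardo_full \<Omega> s p \<alpha> \<beta> f"
  unfolding gagliardo_truncated_def gagliardo_full_def
proof (rule nn_integral_mono)
  fix x
  show "(\<integral>\<^sup>+y\<in>ball x (\<theta> * bdist \<Omega> x). ennreal (gagliardo_kernel \<Omega> s p \<alpha> \<beta> f x y) \<partial>lebesgue)
          * indicator \<Omega> x
      \<le> (\<integral>\<^sup>+y\<in>\<Omega>. ennreal (gagliardo_kernel \<Omega> s p \<alpha> \<beta> f x y) \<partial>lebesgue) * indicator \<Omega> x"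
  proof (cases "x \<in> \<Omega>")
    case True
    then show ?thesis
      using ball_bdist_subset[OF True assms]
      by (intro mult_right_mono nn_integral_mono) (auto split: split_indicator)
  qed simp
qed

end

theory Submission
  imports Defs
begin

text \<open>Write \<open>\<delta>\<close> for the distance to the boundary, \<open>\<tau> = \<theta> / 2\<close>, \<open>s p = 2 e\<close>, let \<open>F z\<close> be the
  mean of \<open>f\<close> over the ball of radius \<open>\<eta> \<delta>(z)\<close> about \<open>z\<close>, and \<open>G u\<close> the inner integral of the
  unweighted truncated seminorm at \<open>u\<close>. Pairs with \<open>|x - y| < \<theta> \<delta>(x)\<close> are harmless. For any
  other pair put \<open>D = |x - y|\<close>; the curve from \<open>x\<close> to \<open>y\<close> contains, for each dyadic scale \<open>r\<close> between
  \<open>\<delta>(x)\<close> and \<open>D\<close>, a point at distance about \<open>r\<close> from \<open>x\<close> and of depth about \<open>r\<close>.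
  Consecutive points are joined by boundedly many overlapping balls, and each overlap changes the
  mean, to the power \<open>p\<close>, by at most the integral of \<open>\<delta>^(2 e - n) G\<close> over a ball. Losing a factor
  \<open>(D / r)^e\<close> makes the sum over the scales geometric, so that \<open>|f x - f y|^p\<close> is bounded by \<open>D^e\<close> times
  \<open>\<delta>(x)^e G x\<close> plus the integral of \<open>\<delta>(w)^(e - n) G w\<close> over the points \<open>w\<close> with
  \<open>|w - x| \<le> K \<delta>(w)\<close> and \<open>\<delta>(w) \<le> K D\<close>, plus the same with \<open>y\<close> in place of \<open>x\<close>. Now
  integrate in \<open>x\<close> and \<open>y\<close> first: the codimension hypothesis gives
  \<open>\<integral> \<delta>^(-b) \<le> C R^(n - b)\<close> on balls of radius \<open>R \<ge> \<delta>(x)\<close>, and all powers of \<open>\<delta>(w)\<close> combine to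
  \<open>\<delta>(w)^(-\<alpha> - \<beta>)\<close>. Discarding \<open>f\<close> on a null set makes it Borel, hence Tonelli's theorem
  applicable.\<close>

section \<open>Convexity, means and dyadic scales\<close>

text \<open>The factor \<open>lam\<close> on the first power may be as close to 1 as desired, at the
  cost of a large factor on the second; this lets \<open>chain\<close> absorb a new link at every
  scale. With (1 + t)^p = \<open>lam\<close>, either b \<le> t a and the sum is charged to a, or a
  \<le> b / t and it is charged to b.\<close>

lemma powr_add_le:
  fixes lam p :: real
  assumes "1 < lam" "0 < p"
  shows "\<exists>C>0. \<forall>a\<ge>0. \<forall>b\<ge>0. (a + b) powr p \<le> lam * a powr p + C * b powr p"
proof -
  define t where "t = lam powr (1 / p) - 1"
  have "1 powr (1 / p) < lam powr (1 / p)"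
    using assms by (intro powr_less_mono2) auto
  then have t: "0 < t" "(1 + t) powr p = lam"
    using assms by (auto simp: t_def powr_powr)
  have "(a + b) powr p \<le> lam * a powr p + (1 + 1 / t) powr p * b powr p"
    if ab: "0 \<le> a" "0 \<le> b" for a b
  proof (cases "b \<le> t * a")
    case True
    have "(a + b) powr p \<le> ((1 + t) * a) powr p"
      using ab True assms by (intro powr_mono2) (auto simp: algebra_simps)
    also have "\<dots> = lam * a powr p"
      using ab t by (simp add: powr_mult)
    finally show ?thesis
      by (smt (verit) mult_nonneg_nonneg powr_ge_zero)
  next
    case False
    then have "a \<le> b / t"
      using t by (simp add: field_simps)
    then have "(a + b) powr p \<le> ((1 + 1 / t) * b) powr p"
      using ab assms by (intro powr_mono2) (auto simp: algebra_simps)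
    also have "\<dots> = (1 + 1 / t) powr p * b powr p"
      using ab t by (simp add: powr_mult)
    finally show ?thesis
      using assms by (smt (verit) mult_nonneg_nonneg powr_ge_zero)
  qed
  moreover have "(1 + 1 / t) powr p > 0"
    using t by (simp add: add_pos_pos add_nonneg_eq_0_iff)
  ultimately show ?thesis
    by blast
qed

lemma powr_add_le_twice:
  fixes p a b :: real
  assumes "0 \<le> p" "0 \<le> a" "0 \<le> b"
  shows "(a + b) powr p \<le> 2 powr p * (a powr p + b powr p)"
proof -
  have "(a + b) powr p \<le> (2 * max a b) powr p"
    using assms by (intro powr_mono2) auto
  also have "\<dots> = 2 powr p * (max a b) powr p"
    using assms by (simp add: powr_mult)
  also have "\<dots> \<le> 2 powr p * (a powr p + b powr p)"
    by (intro mult_left_mono) (auto simp: max_def)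
  finally show ?thesis .
qed

text \<open>The sum is at most N times its largest term. The factor N^p is harmless because chains
  at one scale have bounded length.\<close>

lemma sum_powr_le:
  fixes p :: real and a :: "nat \<Rightarrow> real"
  assumes p: "0 < p" and a: "\<And>i. i < N \<Longrightarrow> 0 \<le> a i"
    and Y: "\<And>i. i < N \<Longrightarrow> ennreal (a i powr p) \<le> Y"
  shows "ennreal ((\<Sum>i<N. a i) powr p) \<le> ennreal (real N powr p) * Y"
proof (cases "N = 0")
  case True
  then show ?thesis using p by simp
next
  case False
  define M where "M = Max (a ` {..<N})"
  have "M \<in> a ` {..<N}"
    unfolding M_def using False by (intro Max_in) auto
  then obtain j where j: "j < N" "M = a j" by auto
  have "(\<Sum>i<N. a i) \<le> (\<Sum>i<N. M)"
    unfolding M_def by (intro sum_mono) auto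
  then have "(\<Sum>i<N. a i) powr p \<le> (real N * a j) powr p"
    using p a j by (intro powr_mono2 sum_nonneg) auto
  also have "\<dots> = real N powr p * a j powr p"
    using a j by (simp add: powr_mult)
  finally have "ennreal ((\<Sum>i<N. a i) powr p) \<le> ennreal (real N powr p * a j powr p)"
    by (rule ennreal_leI)
  also have "\<dots> \<le> ennreal (real N powr p) * Y"
    using Y[OF j(1)] by (simp add: ennreal_mult' mult_left_mono)
  finally show ?thesis .
qed

text \<open>The graph of t^p lies above its tangent at a: t^p \<ge> a^p + p a^(p - 1) (t - a). The
  case p = 1 is separate because it has no finite conjugate exponent.\<close>

lemma Young_affine:
  fixes p a t :: real
  assumes "1 \<le> p" "0 < a" "0 \<le> t"
  shows "p * a powr (p - 1) * t \<le> t powr p + (p - 1) * a powr p"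
proof (cases "p = 1")
  case True
  then show ?thesis using assms by simp
next
  case False
  then have p: "1 < p" using assms by simp
  define q where "q = p / (p - 1)"
  have "t * a powr (p - 1) \<le> t powr p / p + (a powr (p - 1)) powr q / q"
    using p assms by (intro Youngs_inequality) (auto simp: q_def field_simps)
  also have "(a powr (p - 1)) powr q = a powr p"
    using p by (simp add: powr_powr q_def)
  finally have "p * (t * a powr (p - 1)) \<le> p * (t powr p / p + a powr p / q)"
    using p by (intro mult_left_mono) auto
  also have "\<dots> = t powr p + (p - 1) * a powr p"
    using p by (simp add: q_def field_simps)
  finally show ?thesis by (simp add: mult_ac)
qed

text \<open>Jensen's inequality for the mean over S, multiplied by the volume; the right side may be
  infinite. The inequality \<open>Young_affine\<close> for |f - c|, with the tangent at a = |mean -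
  c|, is integrated and combined with the bound of a V by the integral of |f - c|.\<close>

lemma mean_value_powr_le:
  fixes f :: "'a::euclidean_space \<Rightarrow> real"
  assumes f[measurable]: "f \<in> borel_measurable borel" and S[measurable]: "S \<in> sets borel"
    and fS: "set_integrable lborel S f"
    and mS: "emeasure lborel S = ennreal V" "0 < V" and p: "1 \<le> p"
  shows "ennreal (\<bar>(LINT x:S|lborel. f x) / V - c\<bar> powr p) * ennreal V
      \<le> (\<integral>\<^sup>+x. ennreal (\<bar>f x - c\<bar> powr p) * indicator S x \<partial>lborel)"
proof -
  define a where "a = \<bar>(LINT x:S|lborel. f x) / V - c\<bar>"
  have mV: "measure lborel S = V"
    using mS by (simp add: measure_def)
  have cS: "set_integrable lborel S (\<lambda>x. c)" for c
    unfolding set_integrable_def using mS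
    by (intro integrable_scaleR_left impI integrable_real_indicator) auto
  have dS: "set_integrable lborel S (\<lambda>x. f x - c)"
    using fS cS by (rule set_integral_diff)
  have "(LINT x:S|lborel. f x - c) = (LINT x:S|lborel. f x) - c * V"
    using fS cS by (subst set_integral_diff) (auto simp: set_lebesgue_integral_def mV)
  also have "\<dots> = V * ((LINT x:S|lborel. f x) / V - c)"
    using mS by (simp add: field_simps)
  finally have "a * V = \<bar>LINT x:S|lborel. f x - c\<bar>"
    using mS by (simp add: a_def abs_mult)
  also have "\<dots> \<le> (LINT x:S|lborel. \<bar>f x - c\<bar>)"
    using set_integral_norm_bound[OF dS] by simp
  finally have "ennreal (a * V) \<le> ennreal (LINT x:S|lborel. \<bar>f x - c\<bar>)"
    by (rule ennreal_leI)
  also have "\<dots> = (\<integral>\<^sup>+x. ennreal (\<bar>f x - c\<bar> * indicator S x) \<partial>lborel)"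
    unfolding set_lebesgue_integral_def using set_integrable_abs[OF dS]
    by (subst nn_integral_eq_integral)
       (auto simp: set_integrable_def mult.commute split: split_indicator)
  finally have aV: "ennreal (a * V) \<le> (\<integral>\<^sup>+x. ennreal (\<bar>f x - c\<bar> * indicator S x) \<partial>lborel)" .
  show ?thesis
  proof (cases "a = 0")
    case True
    then show ?thesis by (simp add: a_def)
  next
    case False
    then have a: "0 < a" by (simp add: a_def)
    have "ennreal (p * a powr (p - 1)) * ennreal (a * V)
        \<le> (\<integral>\<^sup>+x. ennreal (p * a powr (p - 1)) * ennreal (\<bar>f x - c\<bar> * indicator S x) \<partial>lborel)"
      by (subst nn_integral_cmult) (auto intro!: mult_left_mono aV)
    also have "\<dots> \<le> (\<integral>\<^sup>+x. ennreal (\<bar>f x - c\<bar> powr p) * indicator S x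
        + ennreal ((p - 1) * a powr p) * indicator S x \<partial>lborel)"
      using p a Young_affine[OF p a]
      by (intro nn_integral_mono)
         (auto simp: ennreal_mult'[symmetric] ennreal_plus[symmetric] simp del: ennreal_plus
           split: split_indicator intro!: ennreal_leI)
    also have "\<dots> = (\<integral>\<^sup>+x. ennreal (\<bar>f x - c\<bar> powr p) * indicator S x \<partial>lborel)
        + ennreal ((p - 1) * a powr p * V)"
      using mS p by (subst nn_integral_add) (auto simp: nn_integral_cmult_indicator ennreal_mult)
    finally have *: "ennreal (p * a powr (p - 1) * (a * V))
        \<le> (\<integral>\<^sup>+x. ennreal (\<bar>f x - c\<bar> powr p) * indicator S x \<partial>lborel)
        + ennreal ((p - 1) * a powr p * V)"
      using p a mS by (simp add: ennreal_mult')
    have "p * a powr (p - 1) * (a * V) = a powr p * V + (p - 1) * a powr p * V"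
      using a by (simp add: powr_diff field_simps)
    with * have "ennreal ((p - 1) * a powr p * V) + ennreal (a powr p * V)
        \<le> ennreal ((p - 1) * a powr p * V)
          + (\<integral>\<^sup>+x. ennreal (\<bar>f x - c\<bar> powr p) * indicator S x \<partial>lborel)"
      using p mS by (simp add: ennreal_plus[symmetric] add.commute del: ennreal_plus)
    \<comment> \<open>The cancelled term is a real number, so cancellation is legitimate even when
      the integral is infinite.\<close>
    then have "ennreal (a powr p * V)
        \<le> (\<integral>\<^sup>+x. ennreal (\<bar>f x - c\<bar> powr p) * indicator S x \<partial>lborel)"
      by (subst (asm) ennreal_add_left_cancel_le) auto
    then show ?thesis
      using mS by (simp add: a_def ennreal_mult')
  qed
qed

section \<open>Dyadic scales, geometric series and chords of curves\<close>

lemma dyadic_bracket: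
  fixes t :: real
  assumes "1 \<le> t"
  shows "\<exists>k::nat. 2 ^ k \<le> t \<and> t < 2 * 2 ^ k"
proof -
  obtain m :: nat where m: "t < 2 ^ m"
    using real_arch_pow[of 2 t] by auto
  then show ?thesis
  proof (induction m)
    case 0
    then show ?case using assms by simp
  next
    case (Suc m)
    then show ?case by (cases "t < 2 ^ m") (auto intro!: exI[of _ m])
  qed
qed

lemma suminf_geometric_powr:
  fixes c u A :: real
  assumes "0 \<le> A" "0 < u"
  shows "(\<Sum>j. ennreal (A * (2 ^ j) powr (- u))) = ennreal (A / (1 - 2 powr (- u)))"
proof -
  have "(2 ^ j) powr (- u) = (2 powr (- u)) ^ j" for j
    by (metis powr_power powr_realpow zero_less_numeral mult.commute powr_powr zero_neq_numeral)
  moreover have "2 powr (- u) < 1"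
    using assms powr_less_mono[of "-u" 0 2] by simp
  ultimately have "(\<lambda>j. A * (2 ^ j) powr (- u)) sums (A * (1 / (1 - 2 powr (- u))))"
    using sums_mult[OF geometric_sums[of "2 powr (- u)"], of A] by simp
  then show ?thesis
    using assms by (subst suminf_ennreal_eq) auto
qed

text \<open>The chord is the inscribed polygon with a single edge, so its length is at most the
  supremum that defines \<open>curve_length\<close>.\<close>

lemma arc_length_param_dist:
  assumes "arc_length_param \<gamma> l" "0 \<le> a" "a \<le> b" "b \<le> l"
  shows "dist (\<gamma> a) (\<gamma> b) \<le> b - a"
proof -
  have "ennreal (\<Sum>i<Suc 0. dist (\<gamma> (if i = 0 then a else b)) (\<gamma> (if Suc i = 0 then a else b)))
      \<le> curve_length \<gamma> a b"
    unfolding curve_length_def using assms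
    by (intro SUP_upper2[of "(Suc 0, \<lambda>i. if i = 0 then a else b)"]) (auto simp: mono_on_def)
  also have "\<dots> = ennreal (b - a)"
    using assms by (simp add: arc_length_param_def)
  finally show ?thesis using assms by (simp add: ennreal_le_iff)
qed

section \<open>Chains of balls\<close>

lemma ennreal_mult_le_imp_le_divide:
  fixes X Y :: ennreal
  assumes "X * ennreal V \<le> ennreal A * Y" "0 < V" "0 \<le> A"
  shows "X \<le> ennreal (A / V) * Y"
proof -
  have "X = X * ennreal V * ennreal (1 / V)"
    using assms by (simp add: mult.assoc ennreal_mult[symmetric])
  also have "\<dots> \<le> ennreal A * Y * ennreal (1 / V)"
    using assms by (intro mult_right_mono) auto
  also have "\<dots> = ennreal (A / V) * Y"
    using assms by (simp add: divide_inverse ennreal_mult mult_ac)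
  finally show ?thesis .
qed

lemma emeasure_ball_powr:
  fixes c :: "'a::euclidean_space"
  assumes "0 < r"
  shows "emeasure lborel (ball c r) = ennreal (unit_ball_vol (real DIM('a)) * r powr real DIM('a))"
  using assms by (simp add: emeasure_ball powr_realpow)

text \<open>The theorem instantiates this with e = s p / 2 and \<tau> = \<theta> / 2; n is the
  dimension as a real number, for use in exponents. Arc length is replaced by the Lipschitz bound it
  implies, and the uniformity inequality is multiplied out by \<open>C0\<close>.\<close>

locale uniform_setup =
  fixes \<Omega> :: "'a::euclidean_space set" and C0 e \<tau> p n :: real
  assumes n_eq: "n = real DIM('a)" and open_dom: "open \<Omega>" and nonempty_dom: "\<Omega> \<noteq> {}" and bounded_dom: "bounded \<Omega>"
    and C0: "1 \<le> C0" and e: "0 < e" and tau: "0 < \<tau>" "\<tau> \<le> 1 / 2" and p: "1 \<le> p"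
    and curve: "\<And>x y. x \<in> \<Omega> \<Longrightarrow> y \<in> \<Omega> \<Longrightarrow> \<exists>\<gamma> l. 0 \<le> l \<and> continuous_on {0..l} \<gamma> \<and>
      \<gamma> ` {0..l} \<subseteq> \<Omega> \<and> \<gamma> 0 = x \<and> \<gamma> l = y \<and> l \<le> C0 * dist x y \<and>
      (\<forall>a b. 0 \<le> a \<longrightarrow> a \<le> b \<longrightarrow> b \<le> l \<longrightarrow> dist (\<gamma> a) (\<gamma> b) \<le> b - a) \<and>
      (\<forall>t\<in>{0..l}. min (dist (\<gamma> t) x) (dist (\<gamma> t) y) \<le> C0 * bdist \<Omega> (\<gamma> t))"
begin

abbreviation \<delta> :: "'a \<Rightarrow> real" where "\<delta> \<equiv> bdist \<Omega>"
abbreviation \<omega> :: real where "\<omega> \<equiv> unit_ball_vol n"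

text \<open>Small enough for \<open>point_mean_le\<close>: 4 \<eta> \<delta> z = \<tau> \<delta> z /
  2 stays below \<tau> \<delta> u for all u within three radii \<eta> \<delta> z of z.\<close>

definition \<eta> :: real where "\<eta> = \<tau> / 8"

text \<open>Borel measurability on the whole space serves Tonelli's theorem; integrability is asked
  on the kind of ball over which \<open>F\<close> averages.\<close>

definition nice :: "('a \<Rightarrow> real) \<Rightarrow> bool" where
  "nice f \<longleftrightarrow> f \<in> borel_measurable borel \<and>
    (\<forall>x r. cball x r \<subseteq> \<Omega> \<longrightarrow> set_integrable lborel (ball x r) f)"

definition G :: "('a \<Rightarrow> real) \<Rightarrow> 'a \<Rightarrow> ennreal" where
  "G f u = (\<integral>\<^sup>+v. (if dist u v < \<tau> * \<delta> u
     then ennreal (\<bar>f u - f v\<bar> powr p / dist u v powr (n + 2 * e)) else 0) \<partial>lborel)"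

definition F :: "('a \<Rightarrow> real) \<Rightarrow> 'a \<Rightarrow> real" where
  "F f z = (LINT v:ball z (\<eta> * \<delta> z)|lborel. f v) / (\<omega> * (\<eta> * \<delta> z) powr n)"

section \<open>Measurability and elementary properties of the boundary distance\<close>

lemma eta: "0 < \<eta>" "\<eta> \<le> 1 / 16"
  using tau by (auto simp: \<eta>_def)

lemma n_pos: "0 < n"
  by (simp add: n_eq)

lemma omega_pos: "0 < \<omega>"
  using n_pos by simp

lemma niceD [measurable_dest]: "nice f \<Longrightarrow> f \<in> borel_measurable borel"
  by (simp add: nice_def)

lemma delta_measurable [measurable]: "\<delta> \<in> borel_measurable borel"
  by (intro borel_measurable_continuous_onI continuous_intros)

lemma G_measurable [measurable]:
  assumes [measurable]: "nice f"
  shows "G f \<in> borel_measurable borel"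
proof -
  have [measurable]: "\<delta> \<in> borel_measurable lborel" "f \<in> borel_measurable lborel"
    by simp_all
  have "(\<lambda>u. G f u) \<in> borel_measurable lborel"
    unfolding G_def by measurable
  then show ?thesis by simp
qed

lemma delta_pos: "x \<in> \<Omega> \<Longrightarrow> 0 < \<delta> x"
proof -
  assume x: "x \<in> \<Omega>"
  \<comment> \<open>\<open>infdist\<close> to the empty set is 0, so positivity depends on a
    nonempty frontier; only the empty set and the whole space have an empty one.\<close>
  have "frontier \<Omega> \<noteq> {}"
    using nonempty_dom bounded_dom frontier_eq_empty not_bounded_UNIV by metis
  moreover have "x \<notin> frontier \<Omega>"
    using x open_dom by (simp add: frontier_def interior_open)
  ultimately show ?thesis
    by (intro infdist_pos_not_in_closed) auto
qed

lemma delta_lipschitz: "\<delta> x \<le> \<delta> y + dist x y"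
  by (rule infdist_triangle)

lemma ball_delta: "x \<in> \<Omega> \<Longrightarrow> dist x y < \<delta> x \<Longrightarrow> y \<in> \<Omega>"
  using ball_bdist_subset[of x \<Omega> 1] by auto

lemma cball_eta_subset: "z \<in> \<Omega> \<Longrightarrow> cball z (\<eta> * \<delta> z) \<subseteq> \<Omega>"
proof
  fix y assume z: "z \<in> \<Omega>" and "y \<in> cball z (\<eta> * \<delta> z)"
  moreover have "\<eta> * \<delta> z < 1 * \<delta> z"
    using eta delta_pos[OF z] by (intro mult_strict_right_mono) auto
  ultimately show "y \<in> \<Omega>"
    using ball_delta[OF z, of y] by auto
qed

lemma mean_powr_le:
  assumes f: "nice f" and z: "z \<in> \<Omega>"
  shows "ennreal (\<bar>c - F f z\<bar> powr p) * ennreal (\<omega> * (\<eta> * \<delta> z) powr n)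
    \<le> (\<integral>\<^sup>+u. (if dist u z < \<eta> * \<delta> z then ennreal (\<bar>f u - c\<bar> powr p) else 0) \<partial>lborel)"
proof -
  have pos: "0 < \<eta> * \<delta> z"
    using eta delta_pos[OF z] by simp
  have V: "0 < \<omega> * (\<eta> * \<delta> z) powr n"
    using pos omega_pos by (intro mult_pos_pos) auto
  have "ennreal (\<bar>F f z - c\<bar> powr p) * ennreal (\<omega> * (\<eta> * \<delta> z) powr n)
    \<le> (\<integral>\<^sup>+u. ennreal (\<bar>f u - c\<bar> powr p) * indicator (ball z (\<eta> * \<delta> z)) u \<partial>lborel)"
    unfolding F_def using f cball_eta_subset[OF z] p V emeasure_ball_powr[OF pos, of z, folded n_eq]
    by (intro mean_value_powr_le) (auto simp: nice_def)
  also have "\<dots> = (\<integral>\<^sup>+u. (if dist u z < \<eta> * \<delta> z then ennreal (\<bar>f u - c\<bar> powr p) else 0) \<partial>lborel)"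
    by (intro nn_integral_cong) (auto simp: dist_commute split: split_indicator)
  finally show ?thesis
    by (simp add: abs_minus_commute)
qed

definition C1 :: real where "C1 = 1 / (\<omega> * \<eta> powr n)"

lemma C1_pos: "0 < C1"
  using eta omega_pos by (simp add: C1_def)

text \<open>By Jensen it suffices to integrate |f v - f u|^p over the ball about z. There |u - v|
  \<le> \<delta> z, so inserting the kernel of \<open>G\<close> costs \<delta>(z)^(n + 2 e);
  division by the volume of the ball leaves \<open>C1\<close> times \<delta>(z)^(2 e).\<close>

lemma point_mean_le:
  assumes f: "nice f" and u: "u \<in> \<Omega>" and z: "z \<in> \<Omega>" and d: "dist u z \<le> 3 * (\<eta> * \<delta> z)"
  shows "ennreal (\<bar>f u - F f z\<bar> powr p) \<le> ennreal (C1 * \<delta> z powr (2 * e)) * G f u"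
proof -
  note [measurable] = f
  have dz: "0 < \<delta> z" using delta_pos[OF z] .
  have ez: "\<eta> * \<delta> z \<le> (1 / 16) * \<delta> z"
    using eta dz by (intro mult_right_mono) auto
  have du: "\<delta> z \<le> \<delta> u + 3 * (\<eta> * \<delta> z)"
    using delta_lipschitz[of z u] d by (simp add: dist_commute)
  \<comment> \<open>Three radii of at most \<delta> z / 16 each are lost.\<close>
  then have "(13 / 16) * \<delta> z \<le> \<delta> u"
    using ez by simp
  then have "\<tau> * ((13 / 16) * \<delta> z) \<le> \<tau> * \<delta> u"
    using tau by (intro mult_left_mono) auto
  moreover have "8 * (\<eta> * \<delta> z) = \<tau> * \<delta> z" "0 < \<tau> * \<delta> z"
    using tau dz by (auto simp: \<eta>_def)
  moreover have "\<tau> * ((13 / 16) * \<delta> z) = (13 / 16) * (\<tau> * \<delta> z)"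
    by simp
  ultimately have tu: "4 * (\<eta> * \<delta> z) < \<tau> * \<delta> u"
    by linarith
  have "(\<integral>\<^sup>+v. (if dist v z < \<eta> * \<delta> z then ennreal (\<bar>f v - f u\<bar> powr p) else 0) \<partial>lborel)
    \<le> (\<integral>\<^sup>+v. ennreal (\<delta> z powr (n + 2 * e)) * (if dist u v < \<tau> * \<delta> u
     then ennreal (\<bar>f u - f v\<bar> powr p / dist u v powr (n + 2 * e)) else 0) \<partial>lborel)"
  proof (intro nn_integral_mono)
    fix v
    show "(if dist v z < \<eta> * \<delta> z then ennreal (\<bar>f v - f u\<bar> powr p) else 0)
      \<le> ennreal (\<delta> z powr (n + 2 * e)) * (if dist u v < \<tau> * \<delta> u
     then ennreal (\<bar>f u - f v\<bar> powr p / dist u v powr (n + 2 * e)) else 0)"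
    proof (cases "dist v z < \<eta> * \<delta> z")
      case True
      have uv: "dist u v < 4 * (\<eta> * \<delta> z)"
        using d True dist_triangle2[of u v z] by linarith
      then have uv': "dist u v < \<tau> * \<delta> u" "dist u v \<le> \<delta> z"
        using tu ez dz by linarith+
      have "\<bar>f v - f u\<bar> powr p
          \<le> \<delta> z powr (n + 2 * e) * (\<bar>f u - f v\<bar> powr p / dist u v powr (n + 2 * e))"
      \<comment> \<open>For u = v the quotient is 0 by the convention on division by zero, and the
        left side is 0 as well.\<close>
      proof (cases "u = v")
        case False
        then have "dist u v powr (n + 2 * e) \<le> \<delta> z powr (n + 2 * e)"
          using uv' e n_pos by (intro powr_mono2) auto
        then have "\<bar>f u - f v\<bar> powr p * dist u v powr (n + 2 * e)
          \<le> \<bar>f u - f v\<bar> powr p * \<delta> z powr (n + 2 * e)"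
          by (intro mult_left_mono) auto
        then show ?thesis
          using False by (simp add: field_simps abs_minus_commute)
      qed simp
      then show ?thesis
        using True uv' by (simp add: ennreal_mult'[symmetric] ennreal_leI)
    qed simp
  qed
  also have "\<dots> = ennreal (\<delta> z powr (n + 2 * e)) * G f u"
    unfolding G_def by (subst nn_integral_cmult) auto
  finally have "ennreal (\<bar>f u - F f z\<bar> powr p) * ennreal (\<omega> * (\<eta> * \<delta> z) powr n)
    \<le> ennreal (\<delta> z powr (n + 2 * e)) * G f u"
    using mean_powr_le[OF f z, of "f u"] by (rule order_trans[rotated])
  then have "ennreal (\<bar>f u - F f z\<bar> powr p)
    \<le> ennreal (\<delta> z powr (n + 2 * e) / (\<omega> * (\<eta> * \<delta> z) powr n)) * G f u"
    using eta dz omega_pos by (intro ennreal_mult_le_imp_le_divide) auto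
  also have "\<delta> z powr (n + 2 * e) / (\<omega> * (\<eta> * \<delta> z) powr n) = C1 * \<delta> z powr (2 * e)"
    using eta dz omega_pos by (simp add: C1_def powr_mult powr_add field_simps)
  finally show ?thesis .
qed

text \<open>Jensen is applied on the ball about z with c = \<open>F f z'\<close>, then
  \<open>point_mean_le\<close> to each u of that ball, which lies within three radii of z'. Since
  \<delta> is comparable at u, z and z', the powers of \<delta> z' and of the volume combine into
  the weight \<delta>(u)^(2 e - n) inside the integral.\<close>

lemma link_le:
  "\<exists>C>0. \<forall>f z z'. nice f \<longrightarrow> z \<in> \<Omega> \<longrightarrow> z' \<in> \<Omega> \<longrightarrow> dist z z' \<le> \<eta> * \<delta> z' \<longrightarrow>
    ennreal (\<bar>F f z - F f z'\<bar> powr p) \<le> ennreal C *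
      (\<integral>\<^sup>+u. (if dist u z < \<eta> * \<delta> z then ennreal (\<delta> u powr (2 * e - n)) * G f u else 0) \<partial>lborel)"
proof (intro exI conjI allI impI)
  \<comment> \<open>The factors 2^(2 e) and 2^n pay for \<delta> z' \<le> 2 \<delta> u and \<delta>
    u \<le> 2 \<delta> z; the denominator comes from the volume.\<close>
  define C where "C = C1 * 2 powr (2 * e) * 2 powr n / (\<omega> * \<eta> powr n)"
  show C: "0 < C"
    using C1_pos eta omega_pos by (simp add: C_def)
  fix f z z'
  assume f: "nice f" and z: "z \<in> \<Omega>" and z': "z' \<in> \<Omega>" and d: "dist z z' \<le> \<eta> * \<delta> z'"
  note [measurable] = f
  have dz: "0 < \<delta> z" "0 < \<delta> z'" using delta_pos z z' by auto
  have ez: "\<eta> * \<delta> z \<le> (1 / 16) * \<delta> z" "\<eta> * \<delta> z' \<le> (1 / 16) * \<delta> z'"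
    using eta dz by (auto intro!: mult_right_mono)
  have zz: "\<delta> z \<le> 2 * \<delta> z'" "(15 / 16) * \<delta> z' \<le> \<delta> z"
    using delta_lipschitz[of z z'] delta_lipschitz[of z' z, unfolded dist_commute[of z' z]] d ez dz
    by linarith+
  let ?V = "\<omega> * (\<eta> * \<delta> z) powr n"
  have "ennreal (\<bar>F f z - F f z'\<bar> powr p) * ennreal ?V
    \<le> (\<integral>\<^sup>+u. (if dist u z < \<eta> * \<delta> z then ennreal (\<bar>f u - F f z'\<bar> powr p) else 0) \<partial>lborel)"
    using mean_powr_le[OF f z, of "F f z'"] by (simp add: abs_minus_commute)
  also have "\<dots> \<le> (\<integral>\<^sup>+u. ennreal (C * ?V) *
     (if dist u z < \<eta> * \<delta> z then ennreal (\<delta> u powr (2 * e - n)) * G f u else 0) \<partial>lborel)"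
  proof (intro nn_integral_mono)
    fix u
    show "(if dist u z < \<eta> * \<delta> z then ennreal (\<bar>f u - F f z'\<bar> powr p) else 0)
      \<le> ennreal (C * ?V) *
     (if dist u z < \<eta> * \<delta> z then ennreal (\<delta> u powr (2 * e - n)) * G f u else 0)"
    proof (cases "dist u z < \<eta> * \<delta> z")
      case True
      then have u: "u \<in> \<Omega>"
        using cball_eta_subset[OF z] by (auto simp: dist_commute)
      have "\<eta> * \<delta> z \<le> \<eta> * (2 * \<delta> z')"
        using zz eta by (intro mult_left_mono) auto
      then have uz': "dist u z' \<le> 3 * (\<eta> * \<delta> z')"
        using True d dist_triangle[of u z' z] by linarith
      have du: "\<delta> z' \<le> 2 * \<delta> u" "\<delta> u \<le> 2 * \<delta> z"
        using delta_lipschitz[of z u, unfolded dist_commute[of z u]] delta_lipschitz[of u z]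
          True ez zz dz by linarith+
      then have du0: "0 < \<delta> u" using dz by auto
      have 1: "\<delta> z' powr (2 * e) \<le> 2 powr (2 * e) * \<delta> u powr (2 * e)"
        using powr_mono2[of "2 * e" "\<delta> z'" "2 * \<delta> u"] dz du e by (simp add: powr_mult)
      have 2: "\<delta> u powr n \<le> 2 powr n * \<delta> z powr n"
        using powr_mono2[of n "\<delta> u" "2 * \<delta> z"] dz du du0 n_pos by (simp add: powr_mult)
      have "\<delta> z' powr (2 * e) * \<delta> u powr n
        \<le> (2 powr (2 * e) * \<delta> u powr (2 * e)) * (2 powr n * \<delta> z powr n)"
        by (intro mult_mono 1 2) auto
      then have "C1 * \<delta> z' powr (2 * e) \<le> C * ?V * \<delta> u powr (2 * e - n)"
        using C1_pos eta dz du0 omega_pos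
        by (simp add: C_def powr_mult powr_diff field_simps)
      then have "ennreal (C1 * \<delta> z' powr (2 * e)) * G f u
          \<le> ennreal (C * ?V * \<delta> u powr (2 * e - n)) * G f u"
        by (intro mult_right_mono ennreal_leI) auto
      then show ?thesis
        using True order_trans[OF point_mean_le[OF f u z' uz']] C eta dz omega_pos
        by (simp add: ennreal_mult mult.assoc)
    qed simp
  qed
  also have "\<dots> = ennreal (C * ?V) * (\<integral>\<^sup>+u. 
     (if dist u z < \<eta> * \<delta> z then ennreal (\<delta> u powr (2 * e - n)) * G f u else 0) \<partial>lborel)"
    by (subst nn_integral_cmult) auto
  finally have "ennreal (\<bar>F f z - F f z'\<bar> powr p) \<le> ennreal (C * ?V / ?V) * (\<integral>\<^sup>+u. 
     (if dist u z < \<eta> * \<delta> z then ennreal (\<delta> u powr (2 * e - n)) * G f u else 0) \<partial>lborel)"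
    using C eta dz omega_pos by (intro ennreal_mult_le_imp_le_divide) auto
  then show "ennreal (\<bar>F f z - F f z'\<bar> powr p) \<le> ennreal C *
      (\<integral>\<^sup>+u. (if dist u z < \<eta> * \<delta> z then ennreal (\<delta> u powr (2 * e - n)) * G f u else 0) \<partial>lborel)"
    using eta dz omega_pos by simp
qed

end

section \<open>Oscillation along a chain\<close>

text \<open>All errors are measured in one possibly infinite quantity S, so chaining them is
  arithmetic of the real coefficients A and B.\<close>

lemma ennreal_powr_triangle:
  fixes p :: real
  assumes "\<forall>a\<ge>0. \<forall>b\<ge>0. (a + b) powr p \<le> lam * a powr p + C * b powr p" "0 \<le> p" "0 \<le> lam" "0 \<le> C"
    and "ennreal (\<bar>x - y\<bar> powr p) \<le> ennreal A * S" "ennreal (\<bar>y - z\<bar> powr p) \<le> ennreal B * S"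
    and "0 \<le> A" "0 \<le> B"
  shows "ennreal (\<bar>x - z\<bar> powr p) \<le> ennreal (lam * A + C * B) * S"
proof -
  have "\<bar>x - z\<bar> powr p \<le> (\<bar>x - y\<bar> + \<bar>y - z\<bar>) powr p"
    using assms by (intro powr_mono2) auto
  also have "\<dots> \<le> lam * \<bar>x - y\<bar> powr p + C * \<bar>y - z\<bar> powr p"
    using assms by simp
  finally have "ennreal (\<bar>x - z\<bar> powr p)
      \<le> ennreal lam * ennreal (\<bar>x - y\<bar> powr p) + ennreal C * ennreal (\<bar>y - z\<bar> powr p)"
    using assms by (simp add: ennreal_mult'[symmetric] ennreal_plus[symmetric] ennreal_leI del: ennreal_plus)
  also have "\<dots> \<le> ennreal lam * (ennreal A * S) + ennreal C * (ennreal B * S)"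
    using assms by (intro add_mono mult_left_mono) auto
  also have "\<dots> = ennreal (lam * A + C * B) * S"
    using assms by (simp add: ennreal_mult distrib_right mult.assoc)
  finally show ?thesis .
qed

context uniform_setup
begin

text \<open>The integration set is a non-tangential approach region at x of aperture K, truncated at
  depth K D. Of the exponent 2 e - n in \<open>link_le\<close>, one e has been given up as a power
  of the scale.\<close>

definition shadow :: "real \<Rightarrow> ('a \<Rightarrow> real) \<Rightarrow> 'a \<Rightarrow> real \<Rightarrow> ennreal" where
  "shadow K f x D = (\<integral>\<^sup>+w. (if w \<in> \<Omega> \<and> dist w x \<le> K * \<delta> w \<and> \<delta> w \<le> K * D
     then ennreal (\<delta> w powr (e - n)) * G f w else 0) \<partial>lborel)"

text \<open>The first term accounts for replacing the value f x by a mean, the second for passing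
  from mean to mean.\<close>

definition osc :: "real \<Rightarrow> ('a \<Rightarrow> real) \<Rightarrow> 'a \<Rightarrow> real \<Rightarrow> ennreal" where
  "osc K f x D = ennreal (\<delta> x powr e) * G f x + shadow K f x D"

lemma shadow_mono:
  assumes "K \<le> K'" "D \<le> D'" "0 \<le> K" "0 \<le> D'"
  shows "shadow K f x D \<le> shadow K' f x D'"
  unfolding shadow_def
proof (rule nn_integral_mono)
  fix w
  have "K * \<delta> w \<le> K' * \<delta> w" "K * D \<le> K' * D'"
    using assms by (auto intro!: mult_right_mono infdist_nonneg
        intro: order_trans[OF mult_left_mono mult_right_mono])
  then show "(if w \<in> \<Omega> \<and> dist w x \<le> K * \<delta> w \<and> \<delta> w \<le> K * D
     then ennreal (\<delta> w powr (e - n)) * G f w else 0) \<le>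
     (if w \<in> \<Omega> \<and> dist w x \<le> K' * \<delta> w \<and> \<delta> w \<le> K' * D'
     then ennreal (\<delta> w powr (e - n)) * G f w else 0)"
    by auto
qed

lemma osc_mono:
  "K \<le> K' \<Longrightarrow> D \<le> D' \<Longrightarrow> 0 \<le> K \<Longrightarrow> 0 \<le> D' \<Longrightarrow> osc K f x D \<le> osc K' f x D'"
  unfolding osc_def by (intro add_left_mono shadow_mono)

lemma shadow_le_osc: "shadow K f x D \<le> osc K f x D"
  by (simp add: osc_def)

text \<open>On the ball about z, \<delta> is at most 4 K r, so one factor \<delta>^e is traded for
  the scale. The ball lies in the approach region because |u - x| \<le> 4 K r and r \<le> 4 K
  \<delta> u; the aperture 16 K^2 is the product of these constants.\<close>

lemma ball_integral_le_shadow: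
  assumes f: "nice f" and z: "z \<in> \<Omega>" and K: "1 \<le> K" and r: "0 < r" "r \<le> 2 * K * \<delta> z" "\<delta> z \<le> 2 * K * r"
    and x: "dist z x \<le> 2 * K * r"
  shows "(\<integral>\<^sup>+u. (if dist u z < \<eta> * \<delta> z then ennreal (\<delta> u powr (2 * e - n)) * G f u else 0) \<partial>lborel)
    \<le> ennreal ((4 * K) powr e * r powr e) * shadow (16 * K\<^sup>2) f x r"
proof -
  note [measurable] = f borel_open[OF open_dom]
  have dz: "0 < \<delta> z" using delta_pos[OF z] .
  have ez: "\<eta> * \<delta> z \<le> (1 / 16) * \<delta> z"
    using eta dz by (intro mult_right_mono) auto
  have "(\<integral>\<^sup>+u. (if dist u z < \<eta> * \<delta> z then ennreal (\<delta> u powr (2 * e - n)) * G f u else 0) \<partial>lborel)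
    \<le> (\<integral>\<^sup>+u. ennreal ((4 * K) powr e * r powr e) * (if u \<in> \<Omega> \<and> dist u x \<le> 16 * K\<^sup>2 * \<delta> u \<and> \<delta> u \<le> 16 * K\<^sup>2 * r
     then ennreal (\<delta> u powr (e - n)) * G f u else 0) \<partial>lborel)"
  proof (intro nn_integral_mono)
    fix u
    show "(if dist u z < \<eta> * \<delta> z then ennreal (\<delta> u powr (2 * e - n)) * G f u else 0)
      \<le> ennreal ((4 * K) powr e * r powr e) * (if u \<in> \<Omega> \<and> dist u x \<le> 16 * K\<^sup>2 * \<delta> u \<and> \<delta> u \<le> 16 * K\<^sup>2 * r
     then ennreal (\<delta> u powr (e - n)) * G f u else 0)"
    proof (cases "dist u z < \<eta> * \<delta> z")
      case True
      then have u: "u \<in> \<Omega>"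
        using cball_eta_subset[OF z] by (auto simp: dist_commute)
      have du: "\<delta> z \<le> 2 * \<delta> u" "\<delta> u \<le> 2 * \<delta> z"
        using delta_lipschitz[of z u, unfolded dist_commute[of z u]] delta_lipschitz[of u z]
          True ez dz by linarith+
      then have du0: "0 < \<delta> u" using dz by auto
      have "2 * K * \<delta> z \<le> 2 * K * (2 * \<delta> u)"
        using du K by (intro mult_left_mono) auto
      then have ru: "r \<le> 4 * K * \<delta> u"
        using r by simp
      have "dist u x \<le> 4 * K * r"
        using dist_triangle[of u x z] True ez dz r(3) x by linarith
      also have "\<dots> \<le> 4 * K * (4 * K * \<delta> u)"
        using ru K by (intro mult_left_mono) auto
      finally have 1: "dist u x \<le> 16 * K\<^sup>2 * \<delta> u"
        by (simp add: power2_eq_square)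
      have 2: "\<delta> u \<le> 4 * K * r"
        using du r(3) by simp
      have "K * 1 \<le> K * K"
        using K by (intro mult_left_mono) auto
      then have "4 * K \<le> 16 * K\<^sup>2"
        using K by (simp add: power2_eq_square)
      then have "4 * K * r \<le> 16 * K\<^sup>2 * r"
        using r by (intro mult_right_mono) auto
      then have 3: "\<delta> u \<le> 16 * K\<^sup>2 * r"
        using 2 by linarith
      have "\<delta> u powr e \<le> (4 * K * r) powr e"
        using 2 du0 e by (intro powr_mono2) auto
      also have "\<dots> = (4 * K) powr e * r powr e"
        using K r by (simp add: powr_mult)
      finally have "\<delta> u powr e * \<delta> u powr (e - n) \<le> (4 * K) powr e * r powr e * \<delta> u powr (e - n)"
        by (rule mult_right_mono) simp
      moreover have "\<delta> u powr (2 * e - n) = \<delta> u powr e * \<delta> u powr (e - n)"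
        by (simp add: powr_add[symmetric])
      ultimately have "ennreal (\<delta> u powr (2 * e - n)) * G f u
          \<le> ennreal ((4 * K) powr e * r powr e * \<delta> u powr (e - n)) * G f u"
        by (intro mult_right_mono ennreal_leI) auto
      then show ?thesis
        using u 1 3 by (simp add: ennreal_mult mult.assoc)
    qed simp
  qed
  also have "\<dots> = ennreal ((4 * K) powr e * r powr e) * shadow (16 * K\<^sup>2) f x r"
    unfolding shadow_def by (subst nn_integral_cmult) auto
  finally show ?thesis .
qed

text \<open>A Harnack chain at one scale: with M = C0 K, the curve from u to v has length at most M
  r and, by uniformity, depth at least r / (2 M). A number of overlapping balls independent of f, r,
  u and v therefore joins u to v.\<close>

lemma harnack:
  assumes K: "1 \<le> K"
  shows "\<exists>C>0. \<forall>f r x u v. nice f \<longrightarrow> 0 < r \<longrightarrow> u \<in> \<Omega> \<longrightarrow> v \<in> \<Omega> \<longrightarrow> r \<le> K * \<delta> u \<longrightarrow> r \<le> K * \<delta> v \<longrightarrow>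
    \<delta> u \<le> K * r \<longrightarrow> dist u v \<le> K * r \<longrightarrow> dist u x \<le> K * r \<longrightarrow>
    ennreal (\<bar>F f u - F f v\<bar> powr p) \<le> ennreal (C * r powr e) * shadow (16 * (C0 * K)\<^sup>2) f x r"
proof -
  obtain CL where CL: "0 < CL" and link: "\<And>f z z'. nice f \<Longrightarrow> z \<in> \<Omega> \<Longrightarrow> z' \<in> \<Omega> \<Longrightarrow>
      dist z z' \<le> \<eta> * \<delta> z' \<Longrightarrow> ennreal (\<bar>F f z - F f z'\<bar> powr p) \<le> ennreal CL *
      (\<integral>\<^sup>+u. (if dist u z < \<eta> * \<delta> z then ennreal (\<delta> u powr (2 * e - n)) * G f u else 0) \<partial>lborel)"
    using link_le by blast
  define M where "M = C0 * K"
  have M: "1 \<le> M" "K \<le> M"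
    using K C0 mult_mono[of 1 C0 1 K] mult_mono[of 1 C0 K K] by (auto simp: M_def)
  \<comment> \<open>With this many equal parameter steps each step has length at most \<eta> r / (2
    M), hence at most \<eta> times the depth of its endpoint.\<close>
  define N where "N = nat \<lceil>2 * M\<^sup>2 / \<eta>\<rceil>"
  have "0 < 2 * M\<^sup>2 / \<eta>"
    using M eta by simp
  then have N: "2 * M\<^sup>2 / \<eta> \<le> N" "0 < N"
    by (auto simp: N_def)
  define C where "C = real N powr p * (CL * (4 * M) powr e)"
  have C: "0 < C"
    using N M CL by (auto simp: C_def)
  show ?thesis
  proof (intro exI[of _ C] conjI allI impI C)
    fix f r x u v
    assume f: "nice f" and r: "0 < r" and u: "u \<in> \<Omega>" and v: "v \<in> \<Omega>" and ru: "r \<le> K * \<delta> u"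
      and rv: "r \<le> K * \<delta> v" and ur: "\<delta> u \<le> K * r" and uv: "dist u v \<le> K * r" and ux: "dist u x \<le> K * r"
    obtain \<gamma> l where \<gamma>: "0 \<le> l" "continuous_on {0..l} \<gamma>"
      "\<gamma> ` {0..l} \<subseteq> \<Omega>" "\<gamma> 0 = u" "\<gamma> l = v" "l \<le> C0 * dist u v"
      and lip: "\<And>a b. 0 \<le> a \<Longrightarrow> a \<le> b \<Longrightarrow> b \<le> l \<Longrightarrow> dist (\<gamma> a) (\<gamma> b) \<le> b - a"
      and unif: "\<And>t. t \<in> {0..l} \<Longrightarrow> min (dist (\<gamma> t) u) (dist (\<gamma> t) v) \<le> C0 * \<delta> (\<gamma> t)"
      using curve[OF u v] by metis
    have "C0 * dist u v \<le> C0 * (K * r)"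
      using uv C0 by (intro mult_left_mono) auto
    then have l: "l \<le> M * r"
      using \<gamma> by (simp add: M_def)
    have Kr: "K * r \<le> M * r"
      using M r by (intro mult_right_mono) auto
    \<comment> \<open>If d is the distance to the nearer of u and v, then r \<le> K
      (\<delta>(\<gamma> t) + d) and d \<le> C0 \<delta>(\<gamma> t).\<close>
    have low: "r \<le> 2 * M * \<delta> (\<gamma> t)" if t: "t \<in> {0..l}" for t
    proof -
      have gt: "\<gamma> t \<in> \<Omega>" using t \<gamma> by auto
      have KM: "K * \<delta> (\<gamma> t) \<le> M * \<delta> (\<gamma> t)"
        using M by (intro mult_right_mono) (auto intro: infdist_nonneg)
      have "K * \<delta> u \<le> K * (\<delta> (\<gamma> t) + dist (\<gamma> t) u)" "K * \<delta> v \<le> K * (\<delta> (\<gamma> t) + dist (\<gamma> t) v)"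
        using delta_lipschitz[of u "\<gamma> t"] delta_lipschitz[of v "\<gamma> t"] K
        by (auto simp: dist_commute intro!: mult_left_mono)
      then have "r \<le> M * \<delta> (\<gamma> t) + K * dist (\<gamma> t) u" "r \<le> M * \<delta> (\<gamma> t) + K * dist (\<gamma> t) v"
        using ru rv KM by (auto simp: distrib_left)
      moreover have "K * min (dist (\<gamma> t) u) (dist (\<gamma> t) v) \<le> K * (C0 * \<delta> (\<gamma> t))"
        using unif[OF t] K by (intro mult_left_mono) auto
      ultimately show ?thesis
        by (auto simp: M_def min_def mult_ac split: if_splits)
    qed
    define z where "z i = \<gamma> (real i * l / real N)" for i :: nat
    have ti: "real i * l / real N \<in> {0..l}" if "i \<le> N" for i
      using that N \<gamma>(1) by (auto simp: field_simps intro!: mult_left_mono)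
    have zO: "z i \<in> \<Omega>" if "i \<le> N" for i
      using ti[OF that] \<gamma>(3) by (auto simp: z_def)
    have z_low: "r \<le> 2 * M * \<delta> (z i)" if "i \<le> N" for i
      using low[OF ti[OF that]] by (simp add: z_def)
    have zu: "dist (z i) u \<le> M * r" if "i \<le> N" for i
      using lip[of 0 "real i * l / real N"] ti[OF that] l \<gamma>(4) by (auto simp: z_def dist_commute)
    have step: "dist (z i) (z (Suc i)) \<le> \<eta> * \<delta> (z (Suc i))" if "i < N" for i
    proof -
      have "dist (z i) (z (Suc i)) \<le> real (Suc i) * l / real N - real i * l / real N"
        unfolding z_def using ti[of i] ti[of "Suc i"] that \<gamma>(1) N
        by (intro lip) (auto simp: field_simps intro!: mult_left_mono)
      also have "\<dots> = l / real N"
        by (simp add: add_divide_distrib algebra_simps)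
      also have "\<dots> \<le> M * r / (2 * M\<^sup>2 / \<eta>)"
        using l N M r eta by (intro frac_le) auto
      also have "\<dots> = \<eta> * (r / (2 * M))"
        using M eta by (simp add: field_simps power2_eq_square)
      also have "\<dots> \<le> \<eta> * \<delta> (z (Suc i))"
        using z_low[of "Suc i"] that M eta by (intro mult_left_mono) (auto simp: field_simps)
      finally show ?thesis .
    qed
    let ?S = "shadow (16 * M\<^sup>2) f x r"
    have le: "ennreal (\<bar>F f (z i) - F f (z (Suc i))\<bar> powr p)
      \<le> ennreal (CL * ((4 * M) powr e * r powr e)) * ?S" if "i < N" for i
    proof -
      have i: "i \<le> N" "Suc i \<le> N" using that by auto
      have "\<delta> (z i) \<le> 2 * M * r"
        using delta_lipschitz[of "z i" u] zu[OF i(1)] ur Kr by linarith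
      moreover have "dist (z i) x \<le> 2 * M * r"
        using dist_triangle[of "z i" x u] zu[OF i(1)] ux Kr by linarith
      ultimately have "(\<integral>\<^sup>+w. (if dist w (z i) < \<eta> * \<delta> (z i) then ennreal (\<delta> w powr (2 * e - n)) * G f w else 0) \<partial>lborel)
        \<le> ennreal ((4 * M) powr e * r powr e) * ?S"
        using f zO i M r z_low by (intro ball_integral_le_shadow) auto
      then have "ennreal CL * (\<integral>\<^sup>+w. (if dist w (z i) < \<eta> * \<delta> (z i) then ennreal (\<delta> w powr (2 * e - n)) * G f w else 0) \<partial>lborel)
        \<le> ennreal CL * (ennreal ((4 * M) powr e * r powr e) * ?S)"
        by (rule mult_left_mono) simp
      then show ?thesis
        using link[OF f zO[OF i(1)] zO[OF i(2)] step[OF that]] CL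
        by (simp add: ennreal_mult mult.assoc)
    qed
    have "F f u - F f v = (\<Sum>i<N. F f (z i) - F f (z (Suc i)))"
      using N \<gamma> by (subst sum_lessThan_telescope') (auto simp: z_def)
    then have "\<bar>F f u - F f v\<bar> \<le> (\<Sum>i<N. \<bar>F f (z i) - F f (z (Suc i))\<bar>)"
      by (simp add: sum_abs)
    then have "ennreal (\<bar>F f u - F f v\<bar> powr p) \<le> ennreal ((\<Sum>i<N. \<bar>F f (z i) - F f (z (Suc i))\<bar>) powr p)"
      using p by (intro ennreal_leI powr_mono2) auto
    also have "\<dots> \<le> ennreal (real N powr p) * (ennreal (CL * ((4 * M) powr e * r powr e)) * ?S)"
      using p le by (intro sum_powr_le) auto
    also have "\<dots> = ennreal (C * r powr e) * ?S"
      using CL by (simp add: C_def ennreal_mult mult_ac)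
    finally show "ennreal (\<bar>F f u - F f v\<bar> powr p) \<le> ennreal (C * r powr e) * shadow (16 * (C0 * K)\<^sup>2) f x r"
      by (simp add: M_def)
  qed
qed

section \<open>Deep points at every scale and the passage through all scales\<close>

text \<open>Along the curve the distance to x runs continuously from 0 to |x - y|, so it takes the
  value r / 2. At that point y is at least as far away, and the minimum in the uniformity condition
  is r / 2.\<close>

lemma corkscrew:
  assumes x: "x \<in> \<Omega>" and y: "y \<in> \<Omega>" and r: "0 < r" "r \<le> dist x y"
  shows "\<exists>z\<in>\<Omega>. dist z x = r / 2 \<and> r \<le> 2 * C0 * \<delta> z"
proof -
  obtain \<gamma> l where \<gamma>: "0 \<le> l" "continuous_on {0..l} \<gamma>" 
      "\<gamma> ` {0..l} \<subseteq> \<Omega>" "\<gamma> 0 = x" "\<gamma> l = y" "l \<le> C0 * dist x y"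
      and "\<And>a b. 0 \<le> a \<Longrightarrow> a \<le> b \<Longrightarrow> b \<le> l \<Longrightarrow> dist (\<gamma> a) (\<gamma> b) \<le> b - a"
      and unif: "\<And>t. t \<in> {0..l} \<Longrightarrow> min (dist (\<gamma> t) x) (dist (\<gamma> t) y) \<le> C0 * \<delta> (\<gamma> t)"
    using curve[OF x y] by metis
  have "\<exists>t. 0 \<le> t \<and> t \<le> l \<and> dist (\<gamma> t) x = r / 2"
    using \<gamma> r by (intro IVT'[of "\<lambda>t. dist (\<gamma> t) x"]) (auto intro!: continuous_intros simp: dist_commute)
  then obtain t where t: "t \<in> {0..l}" "dist (\<gamma> t) x = r / 2" by auto
  have "dist x y \<le> dist (\<gamma> t) x + dist (\<gamma> t) y"
    by (rule dist_triangle3)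
  then have "r / 2 \<le> dist (\<gamma> t) y"
    using t r by linarith
  then show ?thesis
    using unif[OF t(1)] t \<gamma>(3) by (intro bexI[of _ "\<gamma> t"]) (auto simp: min_def split: if_splits)
qed

text \<open>The way from f x to a mean at scale |x - y| passes corkscrew points at the scales 2^k
  \<tau> \<delta> x. Doubling the scale multiplies the accumulated coefficient by \<open>lam\<close>
  and adds one Harnack link, while the allowed bound C r^e grows by 2^e > \<open>lam\<close>; so one
  constant serves any number of scales.\<close>

lemma chain:
  "\<exists>C>0. \<exists>K\<ge>1. \<exists>K'\<ge>1. \<forall>f x y. nice f \<longrightarrow> x \<in> \<Omega> \<longrightarrow> y \<in> \<Omega> \<longrightarrow> \<tau> * \<delta> x \<le> dist x y \<longrightarrow>
    (\<exists>z\<in>\<Omega>. dist z x \<le> dist x y \<and> dist x y \<le> K * \<delta> z \<and> \<delta> z \<le> K * dist x y \<and>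
      ennreal (\<bar>f x - F f z\<bar> powr p) \<le> ennreal (C * dist x y powr e) * osc K' f x (dist x y))"
proof -
  \<comment> \<open>Makes K dominate 2 / \<tau> (depth against scale), 4 C0 (scale against corkscrew
    depth) and 8 (distances against scale).\<close>
  define K where "K = 4 * C0 / \<tau>"
  define K' where "K' = 16 * (C0 * K)\<^sup>2"
  have "4 * (1 / (1 / 2)) \<le> 4 * (C0 / \<tau>)"
    using C0 tau by (intro mult_left_mono frac_le) auto
  then have K8: "8 \<le> K" by (simp add: K_def)
  have "2 / \<tau> \<le> K" "4 * C0 * 1 \<le> 4 * C0 * (1 / \<tau>)"
    using C0 tau by (auto simp: K_def field_simps)
  then have Kt: "2 / \<tau> \<le> K" "4 * C0 \<le> K" by (auto simp: K_def)
  have "1 * 1 \<le> C0 * K" using C0 K8 by (intro mult_mono) auto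
  then have "1 \<le> (C0 * K)\<^sup>2" by simp
  then have K': "1 \<le> K'" by (simp add: K'_def)
  obtain CH where CH: "0 < CH" and har: "\<And>f r x u v. nice f \<Longrightarrow> 0 < r \<Longrightarrow> u \<in> \<Omega> \<Longrightarrow> v \<in> \<Omega> \<Longrightarrow>
    r \<le> K * \<delta> u \<Longrightarrow> r \<le> K * \<delta> v \<Longrightarrow> \<delta> u \<le> K * r \<Longrightarrow> dist u v \<le> K * r \<Longrightarrow> dist u x \<le> K * r \<Longrightarrow>
    ennreal (\<bar>F f u - F f v\<bar> powr p) \<le> ennreal (CH * r powr e) * shadow K' f x r"
    using harnack[of K] K8 unfolding K'_def by auto
  \<comment> \<open>Any value strictly between 1 and 2^e serves: above 1 for
    \<open>powr_add_le\<close>, below 2^e for the geometric gain.\<close>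
  define lam where "lam = 2 powr (e / 2)"
  have lam: "1 < lam" "lam < 2 powr e"
    using e by (auto simp: lam_def intro: powr_less_mono)
  obtain CT where CT: "0 < CT" and tri: "\<forall>a\<ge>0. \<forall>b\<ge>0. (a + b) powr p \<le> lam * a powr p + CT * b powr p"
    using powr_add_le[OF lam(1), of p] p by auto
  \<comment> \<open>The first two summands cover the initial scale; the last one yields the
    induction inequality lam C + CT CH \<le> 2^e C.\<close>
  define C where "C = lam * C1 * \<tau> powr (- e) + CT * CH + CT * CH / (2 powr e - lam)"
  have C_pos: "0 < C"
    using lam C1_pos CT CH tau by (auto simp: C_def intro!: add_pos_pos)
  have C_base: "lam * C1 * \<tau> powr (- e) + CT * CH \<le> C"
    using lam CT CH by (simp add: C_def)
  have "CT * CH = (2 powr e - lam) * (CT * CH / (2 powr e - lam))"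
    using lam by simp
  also have "(2 powr e - lam) * (CT * CH / (2 powr e - lam)) \<le> (2 powr e - lam) * C"
    using lam C1_pos CT CH tau by (intro mult_left_mono) (auto simp: C_def)
  finally have C_step: "lam * C + CT * CH \<le> 2 powr e * C"
    by (simp add: left_diff_distrib)
  \<comment> \<open>The induction is over all corkscrew points z at the scale, since the point z0
    chosen at the smaller scale is unrelated to the z of the next one.\<close>
  have bound: "ennreal (\<bar>f x - F f z\<bar> powr p) \<le> ennreal (C * (2 ^ k * (\<tau> * \<delta> x)) powr e) * osc K' f x (2 ^ k * (\<tau> * \<delta> x))"
    if f: "nice f" and x: "x \<in> \<Omega>" and y: "y \<in> \<Omega>" and z: "z \<in> \<Omega>" "dist z x = 2 ^ k * (\<tau> * \<delta> x) / 2"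
      "2 ^ k * (\<tau> * \<delta> x) \<le> 2 * C0 * \<delta> z" and D: "2 ^ k * (\<tau> * \<delta> x) \<le> dist x y" for f x y z k
    using z D
  proof (induction k arbitrary: z)
    case 0
    define r where "r = \<tau> * \<delta> x"
    have dx: "0 < \<delta> x" using delta_pos[OF x] .
    have r: "0 < r" "\<delta> x = r / \<tau>" using tau dx by (auto simp: r_def)
    have rx: "r \<le> \<delta> x" using tau dx by (auto simp: r_def)
    have Kr: "2 / \<tau> * r \<le> K * r" "8 * r \<le> K * r"
      using mult_right_mono[OF Kt(1), of r] mult_right_mono[OF K8, of r] r(1) by linarith+
    have Kd: "1 * \<delta> x \<le> K * \<delta> x" "2 * C0 * \<delta> z \<le> K * \<delta> z"
      using Kt K8 C0 dx delta_pos[OF 0(1)] by (auto intro!: mult_right_mono)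
    \<comment> \<open>Here r = \<tau> \<delta> x, so one half of the exponent 2 e becomes the factor
      r^e and the other half belongs to \<open>osc\<close>.\<close>
    have "\<delta> x powr (2 * e) = \<delta> x powr e * \<delta> x powr e"
      by (simp add: powr_add[symmetric])
    also have "\<dots> = \<tau> powr (- e) * r powr e * \<delta> x powr e"
      using r(1) tau unfolding r(2) by (simp add: powr_divide powr_minus field_simps)
    finally have "ennreal (C1 * \<delta> x powr (2 * e)) * G f x
        = ennreal (C1 * \<tau> powr (- e) * r powr e) * (ennreal (\<delta> x powr e) * G f x)"
      using C1_pos by (simp add: ennreal_mult mult_ac)
    also have "\<dots> \<le> ennreal (C1 * \<tau> powr (- e) * r powr e) * osc K' f x r"
      by (intro mult_left_mono) (auto simp: osc_def)
    finally have 1: "ennreal (\<bar>f x - F f x\<bar> powr p) \<le> ennreal (C1 * \<tau> powr (- e) * r powr e) * osc K' f x r"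
      using point_mean_le[OF f x x] eta dx by (auto intro: order_trans)
    have "ennreal (\<bar>F f x - F f z\<bar> powr p) \<le> ennreal (CH * r powr e) * shadow K' f x r"
    proof (intro har f x 0(1) r(1))
      show "r \<le> K * \<delta> x" using rx Kd by linarith
      show "r \<le> K * \<delta> z" using 0(3) Kd(2) by (simp add: r_def)
      have "\<delta> x \<le> 2 / \<tau> * r" using r tau by (simp add: divide_right_mono)
      then show "\<delta> x \<le> K * r" using Kr by linarith
      show "dist x z \<le> K * r" "dist x x \<le> K * r"
        using 0(2) Kr r(1) by (auto simp: r_def[symmetric] dist_commute)
    qed
    also have "\<dots> \<le> ennreal (CH * r powr e) * osc K' f x r"
      by (intro mult_left_mono shadow_le_osc) auto
    finally have 2: "ennreal (\<bar>F f x - F f z\<bar> powr p) \<le> ennreal (CH * r powr e) * osc K' f x r" .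
    have "ennreal (\<bar>f x - F f z\<bar> powr p)
        \<le> ennreal (lam * (C1 * \<tau> powr (- e) * r powr e) + CT * (CH * r powr e)) * osc K' f x r"
      using p lam CT CH C1_pos by (intro ennreal_powr_triangle[OF tri _ _ _ 1 2]) auto
    also have "\<dots> \<le> ennreal (C * r powr e) * osc K' f x r"
      using mult_right_mono[OF C_base, of "r powr e"]
      by (intro mult_right_mono ennreal_leI) (auto simp: algebra_simps)
    finally show ?case by (simp add: r_def)
  next
    case (Suc k)
    define r where "r = 2 ^ k * (\<tau> * \<delta> x)"
    have dx: "0 < \<delta> x" using delta_pos[OF x] .
    have r: "0 < r" using tau dx by (simp add: r_def)
    have r2: "2 ^ Suc k * (\<tau> * \<delta> x) = 2 * r" by (simp add: r_def)
    note S = Suc.prems[unfolded r2]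
    have "1 * (\<tau> * \<delta> x) \<le> r"
      unfolding r_def using tau dx by (intro mult_right_mono) auto
    then have xr: "\<delta> x \<le> r / \<tau>" using tau by (simp add: field_simps)
    have "r \<le> dist x y" using S(4) r by linarith
    then obtain z0 where z0: "z0 \<in> \<Omega>" "dist z0 x = r / 2" "r \<le> 2 * C0 * \<delta> z0"
      using corkscrew[OF x y r] by blast
    have Kr: "2 / \<tau> * r \<le> K * r" "8 * r \<le> K * r"
      using mult_right_mono[OF Kt(1), of r] mult_right_mono[OF K8, of r] r by linarith+
    have Kd: "2 * C0 * \<delta> z0 \<le> K * \<delta> z0" "2 * C0 * \<delta> z \<le> K * \<delta> z"
      using Kt C0 delta_pos[OF z0(1)] delta_pos[OF S(1)] by (auto intro!: mult_right_mono)
    have "r * 1 \<le> r * (1 / \<tau>)" using r tau by (intro mult_left_mono) auto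
    then have z0r: "\<delta> z0 \<le> K * r"
      using delta_lipschitz[of z0 x] z0(2) xr Kr(1) r by simp
    have IH: "ennreal (\<bar>f x - F f z0\<bar> powr p) \<le> ennreal (C * r powr e) * osc K' f x r"
      using Suc.IH[of z0] z0 \<open>r \<le> dist x y\<close> unfolding r_def by blast
    also have "\<dots> \<le> ennreal (C * r powr e) * osc K' f x (2 * r)"
      using K' r by (intro mult_left_mono osc_mono) auto
    finally have 1: "ennreal (\<bar>f x - F f z0\<bar> powr p) \<le> ennreal (C * r powr e) * osc K' f x (2 * r)" .
    have "dist z0 z \<le> dist z0 x + dist z x" by (rule dist_triangle2)
    then have "dist z0 z \<le> K * r" using z0(2) S(2) Kr(2) r by linarith
    then have "ennreal (\<bar>F f z0 - F f z\<bar> powr p) \<le> ennreal (CH * r powr e) * shadow K' f x r"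
      using z0 S r Kr(2) Kd z0r by (intro har f) auto
    also have "\<dots> \<le> ennreal (CH * r powr e) * osc K' f x (2 * r)"
      using K' r
      by (intro mult_left_mono order_trans[OF shadow_le_osc osc_mono]) auto
    finally have 2: "ennreal (\<bar>F f z0 - F f z\<bar> powr p) \<le> ennreal (CH * r powr e) * osc K' f x (2 * r)" .
    have "ennreal (\<bar>f x - F f z\<bar> powr p)
        \<le> ennreal (lam * (C * r powr e) + CT * (CH * r powr e)) * osc K' f x (2 * r)"
      using p lam CT CH C_pos by (intro ennreal_powr_triangle[OF tri _ _ _ 1 2]) auto
    also have "\<dots> \<le> ennreal (C * (2 * r) powr e) * osc K' f x (2 * r)"
      using mult_right_mono[OF C_step, of "r powr e"] r
      by (intro mult_right_mono ennreal_leI) (auto simp: algebra_simps powr_mult)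
    finally show ?case unfolding r2 .
  qed
  show ?thesis
  proof (rule exI[of _ C], intro conjI C_pos, rule exI[of _ K], intro conjI, (use K8 in simp),
      rule exI[of _ K'], intro conjI K' allI impI)
    fix f x y
    assume f: "nice f" and x: "x \<in> \<Omega>" and y: "y \<in> \<Omega>" and D: "\<tau> * \<delta> x \<le> dist x y"
    have dx: "0 < \<delta> x" using delta_pos[OF x] .
    have t: "0 < \<tau> * \<delta> x" using tau dx by simp
    \<comment> \<open>The largest dyadic multiple of \<tau> \<delta> x that does not exceed |x - y|;
      stopping there loses less than a factor 2.\<close>
    then obtain k :: nat where "2 ^ k \<le> dist x y / (\<tau> * \<delta> x)" "dist x y / (\<tau> * \<delta> x) < 2 * 2 ^ k"
      using dyadic_bracket[of "dist x y / (\<tau> * \<delta> x)"] D by (auto simp: field_simps)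
    then have k: "2 ^ k * (\<tau> * \<delta> x) \<le> dist x y" "dist x y < 2 * (2 ^ k * (\<tau> * \<delta> x))"
      using tau dx by (auto simp: field_simps)
    define r where "r = 2 ^ k * (\<tau> * \<delta> x)"
    have r: "0 < r" "r \<le> dist x y" "dist x y < 2 * r" using t k by (auto simp: r_def)
    then obtain z where z: "z \<in> \<Omega>" "dist z x = r / 2" "r \<le> 2 * C0 * \<delta> z"
      using corkscrew[OF x y] by blast
    have "1 * (\<tau> * \<delta> x) \<le> r"
      unfolding r_def using tau dx by (intro mult_right_mono) auto
    then have xr: "\<delta> x \<le> r / \<tau>" using tau by (simp add: field_simps)
    have "r * 1 \<le> r * (1 / \<tau>)" using r tau by (intro mult_left_mono) auto
    then have "\<delta> z \<le> 2 / \<tau> * r"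
      using delta_lipschitz[of z x] z(2) xr r by simp
    also have "\<dots> \<le> K * dist x y"
      using Kt K8 r by (intro mult_mono) auto
    finally have 1: "\<delta> z \<le> K * dist x y" .
    have "4 * C0 * \<delta> z \<le> K * \<delta> z"
      using Kt delta_pos[OF z(1)] by (intro mult_right_mono) auto
    then have 2: "dist x y \<le> K * \<delta> z" using r z by linarith
    have "ennreal (\<bar>f x - F f z\<bar> powr p) \<le> ennreal (C * r powr e) * osc K' f x r"
      using bound[OF f x y z(1)] z k(1) unfolding r_def by blast
    also have "\<dots> \<le> ennreal (C * dist x y powr e) * osc K' f x (dist x y)"
      using r K' C_pos e by (intro mult_mono osc_mono ennreal_leI mult_left_mono powr_mono2) auto
    finally show "\<exists>z\<in>\<Omega>. dist z x \<le> dist x y \<and> dist x y \<le> K * \<delta> z \<and> \<delta> z \<le> K * dist x y \<and>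
      ennreal (\<bar>f x - F f z\<bar> powr p) \<le> ennreal (C * dist x y powr e) * osc K' f x (dist x y)"
      using 1 2 z r by (intro bexI[of _ z]) auto
  qed
qed

text \<open>Chains from x and from y end at means of depth comparable to |x - y|, and a last Harnack
  link at that scale joins them. Only two triangle inequalities occur, so the crude factor 2^p
  suffices here.\<close>

lemma far_pair:
  "\<exists>C>0. \<exists>K\<ge>1. \<forall>f x y. nice f \<longrightarrow> x \<in> \<Omega> \<longrightarrow> y \<in> \<Omega> \<longrightarrow> \<tau> * \<delta> x \<le> dist x y \<longrightarrow> \<tau> * \<delta> y \<le> dist x y \<longrightarrow>
      ennreal (\<bar>f x - f y\<bar> powr p)
        \<le> ennreal (C * dist x y powr e) * (osc K f x (dist x y) + osc K f y (dist x y))"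
proof -
  obtain C K K' where C: "0 < C" and K: "1 \<le> K" and K': "1 \<le> K'"
    and ch: "\<And>f x y. nice f \<Longrightarrow> x \<in> \<Omega> \<Longrightarrow> y \<in> \<Omega> \<Longrightarrow> \<tau> * \<delta> x \<le> dist x y \<Longrightarrow>
    (\<exists>z\<in>\<Omega>. dist z x \<le> dist x y \<and> dist x y \<le> K * \<delta> z \<and> \<delta> z \<le> K * dist x y \<and>
      ennreal (\<bar>f x - F f z\<bar> powr p) \<le> ennreal (C * dist x y powr e) * osc K' f x (dist x y))"
    using chain by blast
  \<comment> \<open>The end points z and z' are within |x - y| of x and y, hence at most three times
    that distance apart.\<close>
  define H where "H = 3 * K"
  obtain CH where CH: "0 < CH" and har: "\<And>f r x u v. nice f \<Longrightarrow> 0 < r \<Longrightarrow> u \<in> \<Omega> \<Longrightarrow> v \<in> \<Omega> \<Longrightarrow>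
    r \<le> H * \<delta> u \<Longrightarrow> r \<le> H * \<delta> v \<Longrightarrow> \<delta> u \<le> H * r \<Longrightarrow> dist u v \<le> H * r \<Longrightarrow> dist u x \<le> H * r \<Longrightarrow>
    ennreal (\<bar>F f u - F f v\<bar> powr p) \<le> ennreal (CH * r powr e) * shadow (16 * (C0 * H)\<^sup>2) f x r"
    using harnack[of H] K unfolding H_def by auto
  define L where "L = max K' (16 * (C0 * H)\<^sup>2)"
  have L: "1 \<le> L" "K' \<le> L" "16 * (C0 * H)\<^sup>2 \<le> L" using K' by (auto simp: L_def)
  define A where "A = 2 powr p * C + 2 powr p * (2 powr p * CH + 2 powr p * C)"
  have A: "0 < A" using C CH by (auto simp: A_def intro!: add_pos_pos mult_pos_pos)
  have tri: "\<forall>a\<ge>0. \<forall>b\<ge>0. (a + b) powr p \<le> 2 powr p * a powr p + 2 powr p * b powr p"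
    using powr_add_le_twice[of p] p by (auto simp: distrib_left)
  show ?thesis
  proof (rule exI[of _ A], intro conjI A, rule exI[of _ L], intro conjI L(1) allI impI)
    fix f x y
    assume f: "nice f" and x: "x \<in> \<Omega>" and y: "y \<in> \<Omega>" and D: "\<tau> * \<delta> x \<le> dist x y" "\<tau> * \<delta> y \<le> dist x y"
    define r where "r = dist x y"
    define S where "S = osc L f x r + osc L f y r"
    have "0 < \<tau> * \<delta> x" using delta_pos[OF x] tau by simp
    then have r: "0 < r" using D unfolding r_def by linarith
    obtain z where z: "z \<in> \<Omega>" "dist z x \<le> r" "r \<le> K * \<delta> z" "\<delta> z \<le> K * r"
      and fz: "ennreal (\<bar>f x - F f z\<bar> powr p) \<le> ennreal (C * r powr e) * osc K' f x r"
      using ch[OF f x y D(1)] unfolding r_def by blast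
    obtain z' where z': "z' \<in> \<Omega>" "dist z' y \<le> r" "r \<le> K * \<delta> z'" "\<delta> z' \<le> K * r"
      and fz': "ennreal (\<bar>f y - F f z'\<bar> powr p) \<le> ennreal (C * r powr e) * osc K' f y r"
      using ch[OF f y x] D(2) unfolding r_def dist_commute[of y x] by blast
    have Kr: "1 * r \<le> K * r" "0 < K * \<delta> z" "0 < K * \<delta> z'"
      using K r delta_pos[OF z(1)] delta_pos[OF z'(1)] by auto
    have oL: "osc K' f x r \<le> S" "osc K' f y r \<le> S"
      using osc_mono[of K' L r r f x] osc_mono[of K' L r r f y] L K' r
      unfolding S_def by (auto intro: add_increasing add_increasing2)
    have 1: "ennreal (\<bar>f x - F f z\<bar> powr p) \<le> ennreal (C * r powr e) * S"
      using fz oL(1) by (meson order_trans mult_left_mono zero_le)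
    have 3: "ennreal (\<bar>F f z' - f y\<bar> powr p) \<le> ennreal (C * r powr e) * S"
      using fz' oL(2) by (subst abs_minus_commute) (meson order_trans mult_left_mono zero_le)
    have "dist z z' \<le> dist z x + dist x y + dist z' y"
      using dist_triangle[of z z' x] dist_triangle2[of x z' y] by linarith
    then have "dist z z' \<le> H * r"
      using z(2) z'(2) Kr(1) by (simp add: r_def[symmetric] H_def)
    then have "ennreal (\<bar>F f z - F f z'\<bar> powr p) \<le> ennreal (CH * r powr e) * shadow (16 * (C0 * H)\<^sup>2) f x r"
      using z z' r Kr unfolding H_def by (intro har[unfolded H_def] f) linarith+
    also have "\<dots> \<le> ennreal (CH * r powr e) * S"
      unfolding S_def using L r
      by (intro mult_left_mono add_increasing2 order_trans[OF shadow_le_osc osc_mono]) auto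
    finally have 2: "ennreal (\<bar>F f z - F f z'\<bar> powr p) \<le> ennreal (CH * r powr e) * S" .
    have 4: "ennreal (\<bar>F f z - f y\<bar> powr p) \<le> ennreal (2 powr p * (CH * r powr e) + 2 powr p * (C * r powr e)) * S"
      using p C CH by (intro ennreal_powr_triangle[OF tri _ _ _ 2 3]) auto
    have "ennreal (\<bar>f x - f y\<bar> powr p) \<le> ennreal (2 powr p * (C * r powr e) + 2 powr p * (2 powr p * (CH * r powr e) + 2 powr p * (C * r powr e))) * S"
      using p C CH by (intro ennreal_powr_triangle[OF tri _ _ _ 1 4]) auto
    also have "2 powr p * (C * r powr e) + 2 powr p * (2 powr p * (CH * r powr e) + 2 powr p * (C * r powr e)) = A * r powr e"
      by (simp add: A_def algebra_simps)
    finally show "ennreal (\<bar>f x - f y\<bar> powr p)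
        \<le> ennreal (A * dist x y powr e) * (osc L f x (dist x y) + osc L f y (dist x y))"
      by (simp add: r_def S_def)
  qed
qed

end

section \<open>Integrals of powers of the boundary distance\<close>

lemma le_suminf_ennreal: "f j \<le> (\<Sum>j. f j)" for f :: "nat \<Rightarrow> ennreal"
  using sum_le_suminf[of f "{j}"] by simp

text \<open>The range r < R < diam E is extended to r \<le> R \<le> Rm by letting the constant
  depend on Rm. If r \<ge> d / 4, the ratio r / R is bounded below and the volume of the ball
  suffices. If R \<ge> d and r < d / 4, finitely many balls of radius d / 4 cover E, and the
  hypothesis is applied in the concentric balls of radius d / 2.\<close>

lemma nbhd_measure:
  fixes E :: "'a::euclidean_space set"
  assumes E: "compact E" and diam: "0 < diameter E" and q: "0 \<le> q" and C: "1 \<le> C"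
    and assouad: "\<And>x r R. x \<in> E \<Longrightarrow> 0 < r \<Longrightarrow> r < R \<Longrightarrow> R < diameter E \<Longrightarrow>
      measure lebesgue (closed_nbhd E r \<inter> ball x R) \<le> C * measure lebesgue (ball x R) * (r / R) powr q"
  shows "\<exists>A>0. \<forall>x\<in>E. \<forall>r R. 0 < r \<longrightarrow> r \<le> R \<longrightarrow> R \<le> Rm \<longrightarrow>
    emeasure lborel (closed_nbhd E r \<inter> ball x R) \<le> ennreal (A * R powr real DIM('a) * (r / R) powr q)"
proof -
  define n where "n = real DIM('a)"
  define w where "w = unit_ball_vol n"
  define d where "d = diameter E"
  have w: "0 < w" by (simp add: w_def n_def)
  have d: "0 < d" using diam by (simp add: d_def)
  have vol: "emeasure lborel (ball x R) = ennreal (w * R powr n)" if "0 < R" for x :: 'a and R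
    using emeasure_ball_powr[OF that] by (simp add: w_def n_def)
  have meas [measurable]: "closed_nbhd E r \<in> sets borel" for r
    unfolding closed_nbhd_def by (intro borel_closed closed_Collect_le continuous_intros)
  have small: "emeasure lborel (closed_nbhd E r \<inter> ball x R) \<le> ennreal (C * w * R powr n * (r / R) powr q)"
    if "x \<in> E" "0 < r" "r < R" "R < d" for x r R
  proof -
    have "emeasure lborel (closed_nbhd E r \<inter> ball x R) < \<infinity>"
      by (intro emeasure_bounded_finite bounded_Int) auto
    then have "emeasure lborel (closed_nbhd E r \<inter> ball x R) = ennreal (measure lborel (closed_nbhd E r \<inter> ball x R))"
      by (intro emeasure_eq_ennreal_measure) auto
    also have "measure lborel (closed_nbhd E r \<inter> ball x R) = measure lebesgue (closed_nbhd E r \<inter> ball x R)"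
      by simp
    also have "\<dots> \<le> C * measure lebesgue (ball x R) * (r / R) powr q"
      using that by (intro assouad) (auto simp: d_def)
    also have "measure lebesgue (ball x R) = w * R powr n"
      using vol[of R x] that w by (simp add: measure_def)
    finally show ?thesis
      by (simp add: mult_ac ennreal_leI)
  qed
  have triv: "emeasure lborel (closed_nbhd E r \<inter> ball x R) \<le> ennreal (w * R powr n)" if "0 < R" for x r R
    using vol[OF that, of x] emeasure_mono[of "closed_nbhd E r \<inter> ball x R" "ball x R" lborel] by simp
  have "E \<subseteq> (\<Union>c\<in>E. ball c (d / 4))" using d by auto
  then obtain T where T: "T \<subseteq> E" "finite T" "E \<subseteq> (\<Union>c\<in>T. ball c (d / 4))"
    using compactE_image[OF E, of E "\<lambda>c. ball c (d / 4)"] by auto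
  \<comment> \<open>B r / R is at least 2 r / d, and at least 1 once r \<ge> d / 4, because R \<le>
    Rm. The absolute value keeps B nonnegative for negative Rm, when the claim is vacuous.\<close>
  define B where "B = 4 * \<bar>Rm\<bar> / d"
  define A where "A = C * w + w + w * B powr q + real (card T) * (C * w * B powr q)"
  have Ale: "C * w \<le> A" "w \<le> A" "w * B powr q \<le> A" "real (card T) * (C * w * B powr q) \<le> A" "0 < A"
    using C w by (auto simp: A_def intro!: add_pos_nonneg)
  show ?thesis
  proof (rule exI[of _ A], intro conjI ballI allI impI Ale)
    fix x r R assume x: "x \<in> E" and r: "0 < r" "r \<le> R" "R \<le> Rm"
    let ?S = "closed_nbhd E r \<inter> ball x R"
    let ?X = "R powr n * (r / R) powr q"
    have X: "emeasure lborel ?S \<le> ennreal (A * R powr real DIM('a) * (r / R) powr q)"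
      if "emeasure lborel ?S \<le> ennreal (D * ?X)" "D \<le> A" for D
      using that r mult_right_mono[OF that(2), of ?X]
      by (auto simp: n_def mult_ac elim!: order_trans intro!: ennreal_leI)
    have RB: "1 \<le> (r / R) powr q * B powr q" if "d / 4 \<le> r"
    proof -
      have "1 \<le> r / R * B"
        using that r d mult_mono[of R Rm d "r * 4"] by (simp add: B_def field_simps)
      then have "1 powr q \<le> (r / R * B) powr q"
        using q by (intro powr_mono2) auto
      moreover have "0 \<le> r / R" "0 \<le> B" using r d by (auto simp: B_def)
      ultimately show ?thesis by (simp only: powr_mult powr_one_eq_one)
    qed
    consider "r = R" | "r < R" "R < d" | "d / 4 \<le> r" | "d \<le> R" "r < d / 4"
      using r by linarith
    then show "emeasure lborel ?S \<le> ennreal (A * R powr real DIM('a) * (r / R) powr q)"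
    proof cases
      case 1
      then show ?thesis using triv[of R r x] r by (intro X[OF _ Ale(2)]) auto
    next
      case 2
      then show ?thesis using small[OF x r(1)] by (intro X[OF _ Ale(1)]) (auto simp: mult_ac)
    next
      case 3
      have "w * R powr n * 1 \<le> w * R powr n * ((r / R) powr q * B powr q)"
        using RB[OF 3] w by (intro mult_left_mono) auto
      then show ?thesis using triv[of R r x] r
        by (intro X[OF _ Ale(3)]) (auto simp: mult_ac elim!: order_trans intro!: ennreal_leI)
    next
      case 4
      have "?S \<subseteq> (\<Union>c\<in>T. closed_nbhd E r \<inter> ball c (d / 2))"
      proof
        fix y assume y: "y \<in> ?S"
        obtain z where z: "z \<in> E" "infdist y E = dist y z"
          using infdist_attains_inf[of E y] x compact_imp_closed[OF E] by auto
        then obtain c where c: "c \<in> T" "dist c z < d / 4" using T(3) by auto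
        have "dist c y \<le> dist c z + dist y z" by (rule dist_triangle2)
        also have "dist y z < d / 4" using y z 4 by (simp add: closed_nbhd_def)
        finally have "dist c y < d / 2" using c(2) by linarith
        then show "y \<in> (\<Union>c\<in>T. closed_nbhd E r \<inter> ball c (d / 2))"
          using y c(1) by (intro UN_I) auto
      qed
      then have "emeasure lborel ?S \<le> emeasure lborel (\<Union>c\<in>T. closed_nbhd E r \<inter> ball c (d / 2))"
        using T(2) by (intro emeasure_mono sets.finite_UN) auto
      also have "\<dots> \<le> (\<Sum>c\<in>T. emeasure lborel (closed_nbhd E r \<inter> ball c (d / 2)))"
        using T(2) by (intro emeasure_subadditive_finite) auto
      also have "\<dots> \<le> (\<Sum>c\<in>T. ennreal (C * w * B powr q * ?X))"
      proof (intro sum_mono)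
        fix c assume "c \<in> T"
        then have "emeasure lborel (closed_nbhd E r \<inter> ball c (d / 2))
            \<le> ennreal (C * w * (d / 2) powr n * (r / (d / 2)) powr q)"
          using T(1) 4 r by (intro small) auto
        also have "\<dots> \<le> ennreal (C * w * R powr n * (B * (r / R)) powr q)"
        proof (intro ennreal_leI mult_mono powr_mono2)
          have "2 * R \<le> 4 * \<bar>Rm\<bar>" using r by linarith
          then have "2 * R * r \<le> 4 * \<bar>Rm\<bar> * r"
            using r by (intro mult_right_mono) auto
          then show "r / (d / 2) \<le> B * (r / R)"
            using r d by (simp add: B_def field_simps)
        qed (use 4 r d C w q in \<open>auto simp: n_def\<close>)
        also have "C * w * R powr n * (B * (r / R)) powr q = C * w * B powr q * ?X"
        proof -
          have "0 \<le> B" "0 \<le> r / R" using r d by (auto simp: B_def)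
          then show ?thesis by (simp only: powr_mult mult_ac)
        qed
        finally show "emeasure lborel (closed_nbhd E r \<inter> ball c (d / 2)) \<le> ennreal (C * w * B powr q * ?X)" .
      qed
      also have "\<dots> = ennreal (real (card T) * (C * w * B powr q) * ?X)"
        using C w by (simp add: ennreal_of_nat_eq_real_of_nat ennreal_mult'[symmetric] mult.assoc)
      finally show ?thesis by (rule X[OF _ Ale(4)])
    qed
  qed
qed

text \<open>As b lies below the codimension, the neighbourhood estimate holds for some q > b. Near a
  point z of E closest to x, the shell at distance about S / 2^j from E has measure of order S^n
  2^(- j q) and weight of order S^(- b) 2^(j b), so the sum is geometric with ratio 2^(b -
  q).\<close>

lemma weight_ball_integral:
  fixes E :: "'a::euclidean_space set"
  assumes E: "compact E" and diam: "0 < diameter E" and b: "0 \<le> b" "ereal b < lower_assouad_codim E"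
  shows "\<exists>C>0. \<forall>x R. 0 < R \<longrightarrow> R \<le> Rm \<longrightarrow> infdist x E \<le> R \<longrightarrow>
    (\<integral>\<^sup>+y. (if 0 < infdist y E \<and> dist x y < R then ennreal (infdist y E powr (- b)) else 0) \<partial>lborel)
      \<le> ennreal (C * R powr (real DIM('a) - b))"
proof -
  define n where "n = real DIM('a)"
  have "E \<noteq> {}" using diam by auto
  have meas [measurable]: "closed_nbhd E r \<in> sets borel" for r
    unfolding closed_nbhd_def by (intro borel_closed closed_Collect_le continuous_intros)
  obtain q where q: "b < q" "\<exists>C\<ge>1. \<forall>x\<in>E. \<forall>r R. 0 < r \<and> r < R \<and> (bounded E \<longrightarrow> R < diameter E) \<longrightarrow>
          measure lebesgue (closed_nbhd E r \<inter> ball x R)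
            \<le> C * measure lebesgue (ball x R) * (r / R) powr q"
    using b(2) by (auto simp: lower_assouad_codim_def less_Sup_iff)
  then obtain C where C1: "1 \<le> C" and C: "\<And>x r R. x \<in> E \<Longrightarrow> 0 < r \<Longrightarrow> r < R \<Longrightarrow> R < diameter E \<Longrightarrow>
      measure lebesgue (closed_nbhd E r \<inter> ball x R) \<le> C * measure lebesgue (ball x R) * (r / R) powr q"
    by blast
  have q0: "0 \<le> q" using b(1) q(1) by simp
  have "\<exists>A>0. \<forall>x\<in>E. \<forall>r R. 0 < r \<longrightarrow> r \<le> R \<longrightarrow> R \<le> 2 * Rm \<longrightarrow>
    emeasure lborel (closed_nbhd E r \<inter> ball x R) \<le> ennreal (A * R powr n * (r / R) powr q)"
    unfolding n_def by (rule nbhd_measure[OF E diam q0 C1 C])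
  then obtain A where A: "0 < A" and nb: "\<forall>x\<in>E. \<forall>r R. 0 < r \<longrightarrow> r \<le> R \<longrightarrow> R \<le> 2 * Rm \<longrightarrow>
    emeasure lborel (closed_nbhd E r \<inter> ball x R) \<le> ennreal (A * R powr n * (r / R) powr q)"
    by (elim exE conjE) (rule that)
  define u where "u = q - b"
  have u: "0 < u" using q by (simp add: u_def)
  have "2 powr (- u) < 1"
    using powr_less_mono[of "-u" 0 2] u by simp
  then have u1: "0 < 1 - 2 powr (- u)" by simp
  define D where "D = A * 2 powr b * 2 powr (n - b) / (1 - 2 powr (- u))"
  have D: "0 < D" using A u1 by (simp add: D_def)
  show ?thesis
  proof (rule exI[of _ D], intro conjI D allI impI)
    fix x R assume R: "0 < R" "R \<le> Rm" and x: "infdist x E \<le> R"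
    obtain z where z: "z \<in> E" "infdist x E = dist x z"
      using infdist_attains_inf[OF compact_imp_closed[OF E] \<open>E \<noteq> {}\<close>, of x] by blast
    \<comment> \<open>Since |x - z| \<le> R, the ball of radius R about x lies in the ball of radius
      2 R about z; hence the bound 2 Rm in \<open>nb\<close>.\<close>
    define S where "S = 2 * R"
    have S: "0 < S" "S \<le> 2 * Rm" using R by (auto simp: S_def)
    let ?N = "\<lambda>j::nat. closed_nbhd E (S / 2 ^ j) \<inter> ball z S"
    have "(\<integral>\<^sup>+y. (if 0 < infdist y E \<and> dist x y < R then ennreal (infdist y E powr (- b)) else 0) \<partial>lborel)
      \<le> (\<integral>\<^sup>+y. (\<Sum>j. ennreal ((S / (2 * 2 ^ j)) powr (- b)) * indicator (?N j) y) \<partial>lborel)"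
    proof (intro nn_integral_mono)
      fix y
      show "(if 0 < infdist y E \<and> dist x y < R then ennreal (infdist y E powr (- b)) else 0)
        \<le> (\<Sum>j. ennreal ((S / (2 * 2 ^ j)) powr (- b)) * indicator (?N j) y)"
      proof (cases "0 < infdist y E \<and> dist x y < R")
        case True
        have zy: "dist z y < S"
          using dist_triangle[of z y x] x True unfolding z(2) S_def by (simp add: dist_commute)
        have "infdist y E \<le> dist y z" by (rule infdist_le[OF z(1)])
        then have "1 \<le> S / infdist y E"
          using zy True by (simp add: dist_commute)
        then obtain j :: nat where "2 ^ j \<le> S / infdist y E" "S / infdist y E < 2 * 2 ^ j"
          using dyadic_bracket by blast
        then have j: "infdist y E \<le> S / 2 ^ j" "S / (2 * 2 ^ j) \<le> infdist y E"
          using True by (auto simp: field_simps)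
        have "infdist y E powr (- b) \<le> (S / (2 * 2 ^ j)) powr (- b)"
          using j(2) b S by (intro powr_mono2') auto
        then have "ennreal (infdist y E powr (- b)) \<le> ennreal ((S / (2 * 2 ^ j)) powr (- b)) * indicator (?N j) y"
          using j(1) zy by (simp add: closed_nbhd_def ennreal_leI)
        also have "\<dots> \<le> (\<Sum>j. ennreal ((S / (2 * 2 ^ j)) powr (- b)) * indicator (?N j) y)"
          by (rule le_suminf_ennreal)
        finally show ?thesis using True by simp
      qed auto
    qed
    also have "\<dots> = (\<Sum>j. ennreal ((S / (2 * 2 ^ j)) powr (- b)) * emeasure lborel (?N j))"
    proof -
      have "?N j \<in> sets lborel" for j by simp
      then show ?thesis
        by (subst nn_integral_suminf)
           (simp_all only: nn_integral_cmult_indicator borel_measurable_times_ennreal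
             borel_measurable_indicator borel_measurable_const)
    qed
    also have "\<dots> \<le> (\<Sum>j. ennreal (A * 2 powr b * S powr (n - b) * (2 ^ j) powr (- u)))"
    proof (intro suminf_le summableI)
      fix j
      have "S / 2 ^ j \<le> S / 1" using S by (intro divide_left_mono) auto
      then have "emeasure lborel (?N j) \<le> ennreal (A * S powr n * (S / 2 ^ j / S) powr q)"
        using S z by (intro nb[rule_format]) auto
      then have "ennreal ((S / (2 * 2 ^ j)) powr (- b)) * emeasure lborel (?N j)
        \<le> ennreal ((S / (2 * 2 ^ j)) powr (- b)) * ennreal (A * S powr n * (S / 2 ^ j / S) powr q)"
        by (rule mult_left_mono) simp
      also have "\<dots> = ennreal ((S / (2 * 2 ^ j)) powr (- b) * (A * S powr n * (S / 2 ^ j / S) powr q))"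
        using A by (simp add: ennreal_mult)
      also have "(S / (2 * 2 ^ j)) powr (- b) * (A * S powr n * (S / 2 ^ j / S) powr q)
        = A * 2 powr b * S powr (n - b) * (2 ^ j) powr (- u)"
        using S by (simp add: u_def powr_divide powr_mult powr_diff powr_minus field_simps)
      finally show "ennreal ((S / (2 * 2 ^ j)) powr (- b)) * emeasure lborel (?N j)
        \<le> ennreal (A * 2 powr b * S powr (n - b) * (2 ^ j) powr (- u))" .
    qed
    also have "\<dots> = ennreal (A * 2 powr b * S powr (n - b) / (1 - 2 powr (- u)))"
      using A u by (intro suminf_geometric_powr) auto
    also have "A * 2 powr b * S powr (n - b) / (1 - 2 powr (- u)) = D * R powr (real DIM('a) - b)"
      using R by (simp add: S_def D_def powr_mult n_def)
    finally show "(\<integral>\<^sup>+y. (if 0 < infdist y E \<and> dist x y < R then ennreal (infdist y E powr (- b)) else 0) \<partial>lborel)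
      \<le> ennreal (D * R powr (real DIM('a) - b))" .
  qed
qed

section \<open>Weighted integrals over balls and tails centred in the domain\<close>

context uniform_setup
begin

text \<open>The form in which the codimension hypothesis is used from here on. A constant depending
  on the bound Rm for the radii suffices because \<Omega> is bounded.\<close>

definition admissible :: "real \<Rightarrow> bool" where
  "admissible b \<longleftrightarrow> 0 \<le> b \<and> (\<forall>Rm. \<exists>C>0. \<forall>x R. x \<in> \<Omega> \<longrightarrow> 0 < R \<longrightarrow> R \<le> Rm \<longrightarrow> \<delta> x \<le> R \<longrightarrow>
    (\<integral>\<^sup>+y. (if y \<in> \<Omega> \<and> dist x y < R then ennreal (\<delta> y powr (- b)) else 0) \<partial>lborel)
      \<le> ennreal (C * R powr (n - b)))"

text \<open>What \<open>weight_ball_integral\<close> still requires is a frontier of positive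
  diameter: a line through a point of the bounded open set \<Omega> meets the frontier in both
  directions, at two distinct points.\<close>

lemma admissibleI:
  assumes b: "0 \<le> b" "ereal b < lower_assouad_codim (frontier \<Omega>)"
  shows "admissible b"
  unfolding admissible_def
proof (intro conjI b allI)
  fix Rm :: real
  obtain x where x: "x \<in> interior \<Omega>" using nonempty_dom open_dom by (auto simp: interior_open)
  have fr: "compact (frontier \<Omega>)" using bounded_dom by (simp add: compact_frontier_bounded)
  obtain v :: 'a where v: "v \<in> Basis" using nonempty_Basis by blast
  then have "v \<noteq> 0" "- v \<noteq> 0" by (auto simp: nonzero_Basis)
  obtain t where t: "0 < t" "x + t *\<^sub>R v \<in> frontier \<Omega>"
    using ray_to_frontier[OF bounded_dom x \<open>v \<noteq> 0\<close>] by metis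
  obtain t' where t': "0 < t'" "x + t' *\<^sub>R (- v) \<in> frontier \<Omega>"
    using ray_to_frontier[OF bounded_dom x \<open>- v \<noteq> 0\<close>] by metis
  have "(x + t *\<^sub>R v) - (x + t' *\<^sub>R (- v)) = (t + t') *\<^sub>R v"
    by (simp add: scaleR_add_left)
  then have "x + t *\<^sub>R v \<noteq> x + t' *\<^sub>R (- v)"
    using t t' \<open>v \<noteq> 0\<close> by auto
  then have "0 < diameter (frontier \<Omega>)"
    using diameter_bounded_bound[OF compact_imp_bounded[OF fr] t(2) t'(2)]
    by (metis order_less_le_trans zero_less_dist_iff)
  then obtain C where C: "0 < C" "\<And>x R. 0 < R \<Longrightarrow> R \<le> Rm \<Longrightarrow> \<delta> x \<le> R \<Longrightarrow>
    (\<integral>\<^sup>+y. (if 0 < \<delta> y \<and> dist x y < R then ennreal (\<delta> y powr (- b)) else 0) \<partial>lborel)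
      \<le> ennreal (C * R powr (n - b))"
    using weight_ball_integral[OF fr _ b, of Rm] unfolding n_eq by blast
  show "\<exists>C>0. \<forall>x R. x \<in> \<Omega> \<longrightarrow> 0 < R \<longrightarrow> R \<le> Rm \<longrightarrow> \<delta> x \<le> R \<longrightarrow>
    (\<integral>\<^sup>+y. (if y \<in> \<Omega> \<and> dist x y < R then ennreal (\<delta> y powr (- b)) else 0) \<partial>lborel)
      \<le> ennreal (C * R powr (n - b))"
  proof (intro exI[of _ C] conjI C(1) allI impI)
    fix x R assume "0 < R" "R \<le> Rm" "\<delta> x \<le> R"
    from C(2)[OF this] show "(\<integral>\<^sup>+y. (if y \<in> \<Omega> \<and> dist x y < R then ennreal (\<delta> y powr (- b)) else 0) \<partial>lborel)
      \<le> ennreal (C * R powr (n - b))"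
      by (rule order_trans[rotated]) (auto intro!: nn_integral_mono simp: delta_pos)
  qed
qed

text \<open>The ball is enlarged to radius K R, for which the condition of \<open>admissible\<close>
  holds.\<close>

lemma admissible_ball:
  assumes "admissible b" "1 \<le> K"
  shows "\<exists>C>0. \<forall>x R. x \<in> \<Omega> \<longrightarrow> 0 < R \<longrightarrow> R \<le> Rm \<longrightarrow> \<delta> x \<le> K * R \<longrightarrow>
    (\<integral>\<^sup>+y. (if y \<in> \<Omega> \<and> dist x y < R then ennreal (\<delta> y powr (- b)) else 0) \<partial>lborel)
      \<le> ennreal (C * R powr (n - b))"
proof -
  obtain C where C: "0 < C" "\<And>x R. x \<in> \<Omega> \<Longrightarrow> 0 < R \<Longrightarrow> R \<le> K * Rm \<Longrightarrow> \<delta> x \<le> R \<Longrightarrow>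
    (\<integral>\<^sup>+y. (if y \<in> \<Omega> \<and> dist x y < R then ennreal (\<delta> y powr (- b)) else 0) \<partial>lborel)
      \<le> ennreal (C * R powr (n - b))"
    using assms(1) unfolding admissible_def by blast
  show ?thesis
  proof (intro exI[of _ "C * K powr (n - b)"] conjI allI impI)
    show "0 < C * K powr (n - b)" using C assms by simp
    fix x R assume x: "x \<in> \<Omega>" and R: "0 < R" "R \<le> Rm" "\<delta> x \<le> K * R"
    have "1 * R \<le> K * R" using assms R by (intro mult_right_mono) auto
    then have "(\<integral>\<^sup>+y. (if y \<in> \<Omega> \<and> dist x y < R then ennreal (\<delta> y powr (- b)) else 0) \<partial>lborel)
      \<le> (\<integral>\<^sup>+y. (if y \<in> \<Omega> \<and> dist x y < K * R then ennreal (\<delta> y powr (- b)) else 0) \<partial>lborel)"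
      by (intro nn_integral_mono) auto
    also have "\<dots> \<le> ennreal (C * (K * R) powr (n - b))"
      using assms x R by (intro C(2)) auto
    finally show "(\<integral>\<^sup>+y. (if y \<in> \<Omega> \<and> dist x y < R then ennreal (\<delta> y powr (- b)) else 0) \<partial>lborel)
      \<le> ennreal (C * K powr (n - b) * R powr (n - b))"
      using assms R by (simp add: powr_mult mult_ac)
  qed
qed

lemma bounded_dist: "\<exists>M>0. \<forall>x\<in>\<Omega>. \<forall>y\<in>\<Omega>. dist x y \<le> M"
proof -
  obtain M where "\<forall>x\<in>\<Omega>. \<forall>y\<in>\<Omega>. dist x y \<le> M"
    using bounded_dom bounded_two_points by metis
  then show ?thesis by (intro exI[of _ "max 1 M"]) force
qed

text \<open>On the annulus where |x - y| is about 2^j \<rho>, the kernel is at most (2^j \<rho>)^(-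
  n - e) and the weight integrates to order (2^j \<rho>)^(n - b). The products (2^j \<rho>)^(- e -
  b) form a geometric series because e + b > 0.\<close>

lemma admissible_tail:
  assumes b: "admissible b" and K: "1 \<le> K"
  shows "\<exists>C>0. \<forall>x \<rho>. x \<in> \<Omega> \<longrightarrow> 0 < \<rho> \<longrightarrow> \<delta> x \<le> K * \<rho> \<longrightarrow>
    (\<integral>\<^sup>+y. (if y \<in> \<Omega> \<and> \<rho> \<le> dist x y then ennreal (dist x y powr (- n - e) * \<delta> y powr (- b)) else 0) \<partial>lborel)
      \<le> ennreal (C * \<rho> powr (- e - b))"
proof -
  have [measurable]: "\<Omega> \<in> sets borel" using open_dom by simp
  have b0: "0 \<le> b" using b by (simp add: admissible_def)
  obtain M where M: "0 < M" "\<And>x y. x \<in> \<Omega> \<Longrightarrow> y \<in> \<Omega> \<Longrightarrow> dist x y \<le> M"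
    using bounded_dist by blast
  obtain C where C: "0 < C" and V: "\<And>x R. x \<in> \<Omega> \<Longrightarrow> 0 < R \<Longrightarrow> R \<le> 2 * M \<Longrightarrow> \<delta> x \<le> K * R \<Longrightarrow>
    (\<integral>\<^sup>+y. (if y \<in> \<Omega> \<and> dist x y < R then ennreal (\<delta> y powr (- b)) else 0) \<partial>lborel)
      \<le> ennreal (C * R powr (n - b))"
    using admissible_ball[OF b K, of "2 * M"] by blast
  define u where "u = e + b"
  have u: "0 < u" using e b0 by (simp add: u_def)
  have "2 powr (- u) < 1"
    using powr_less_mono[of "-u" 0 2] u by simp
  then have u1: "0 < 1 - 2 powr (- u)" by simp
  define D where "D = C * 2 powr (n - b) / (1 - 2 powr (- u))"
  have D: "0 < D" using C u1 by (simp add: D_def)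
  show ?thesis
  proof (intro exI[of _ D] conjI D allI impI)
    fix x \<rho> assume x: "x \<in> \<Omega>" and \<rho>: "0 < \<rho>" "\<delta> x \<le> K * \<rho>"
    define T where "T j y = (if y \<in> \<Omega> \<and> 2 ^ j * \<rho> \<le> dist x y \<and> dist x y < 2 * (2 ^ j * \<rho>)
      then ennreal (\<delta> y powr (- b)) else 0)" for j :: nat and y
    have [measurable]: "T j \<in> borel_measurable borel" for j
      unfolding T_def by measurable
    have "(\<integral>\<^sup>+y. (if y \<in> \<Omega> \<and> \<rho> \<le> dist x y then ennreal (dist x y powr (- n - e) * \<delta> y powr (- b)) else 0) \<partial>lborel)
      \<le> (\<integral>\<^sup>+y. (\<Sum>j. ennreal ((2 ^ j * \<rho>) powr (- n - e)) * T j y) \<partial>lborel)"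
    proof (intro nn_integral_mono)
      fix y
      show "(if y \<in> \<Omega> \<and> \<rho> \<le> dist x y then ennreal (dist x y powr (- n - e) * \<delta> y powr (- b)) else 0)
        \<le> (\<Sum>j. ennreal ((2 ^ j * \<rho>) powr (- n - e)) * T j y)"
      proof (cases "y \<in> \<Omega> \<and> \<rho> \<le> dist x y")
        case True
        then obtain j :: nat where "2 ^ j \<le> dist x y / \<rho>" "dist x y / \<rho> < 2 * 2 ^ j"
          using dyadic_bracket[of "dist x y / \<rho>"] \<rho> by (auto simp: field_simps)
        then have j: "2 ^ j * \<rho> \<le> dist x y" "dist x y < 2 * (2 ^ j * \<rho>)"
          using \<rho> by (auto simp: field_simps)
        have "dist x y powr (- n - e) \<le> (2 ^ j * \<rho>) powr (- n - e)"
          using j(1) \<rho> n_pos e by (intro powr_mono2') auto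
        then have "ennreal (dist x y powr (- n - e) * \<delta> y powr (- b))
            \<le> ennreal ((2 ^ j * \<rho>) powr (- n - e)) * T j y"
          using True j by (auto simp: T_def ennreal_mult'[symmetric] intro!: ennreal_leI mult_right_mono)
        also have "\<dots> \<le> (\<Sum>j. ennreal ((2 ^ j * \<rho>) powr (- n - e)) * T j y)"
          by (rule le_suminf_ennreal)
        finally show ?thesis using True by simp
      qed auto
    qed
    also have "\<dots> = (\<Sum>j. ennreal ((2 ^ j * \<rho>) powr (- n - e)) * (\<integral>\<^sup>+y. T j y \<partial>lborel))"
      by (subst nn_integral_suminf) (auto simp: nn_integral_cmult)
    also have "\<dots> \<le> (\<Sum>j. ennreal (C * 2 powr (n - b) * \<rho> powr (- e - b) * (2 ^ j) powr (- u)))"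
    proof (intro suminf_le summableI)
      fix j :: nat
      have "(\<integral>\<^sup>+y. T j y \<partial>lborel) \<le> ennreal (C * (2 * (2 ^ j * \<rho>)) powr (n - b))"
      proof (cases "2 ^ j * \<rho> \<le> M")
        case True
        have "1 * \<rho> \<le> 2 * 2 ^ j * \<rho>" using \<rho>
          by (intro mult_right_mono) (auto intro: order_trans[of _ "2 * 1"])
        then have "K * \<rho> \<le> K * (2 * (2 ^ j * \<rho>))" using K by (intro mult_left_mono) auto
        then have "(\<integral>\<^sup>+y. (if y \<in> \<Omega> \<and> dist x y < 2 * (2 ^ j * \<rho>) then ennreal (\<delta> y powr (- b)) else 0) \<partial>lborel)
          \<le> ennreal (C * (2 * (2 ^ j * \<rho>)) powr (n - b))"
          using True x \<rho> by (intro V) auto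
        then show ?thesis
          by (rule order_trans[rotated]) (auto simp: T_def intro!: nn_integral_mono)
      next
        \<comment> \<open>An annulus whose inner radius exceeds the bound M on distances contains no
          point of \<Omega>; so \<open>V\<close> is needed only for radii up to 2 M.\<close>
        case False
        then have "T j y = 0" for y using M(2)[OF x, of y] by (auto simp: T_def)
        then show ?thesis by simp
      qed
      then have "ennreal ((2 ^ j * \<rho>) powr (- n - e)) * (\<integral>\<^sup>+y. T j y \<partial>lborel)
        \<le> ennreal ((2 ^ j * \<rho>) powr (- n - e)) * ennreal (C * (2 * (2 ^ j * \<rho>)) powr (n - b))"
        by (rule mult_left_mono) simp
      also have "\<dots> = ennreal ((2 ^ j * \<rho>) powr (- n - e) * (C * (2 * (2 ^ j * \<rho>)) powr (n - b)))"
        using C by (simp add: ennreal_mult)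
      also have "(2 ^ j * \<rho>) powr (- n - e) * (C * (2 * (2 ^ j * \<rho>)) powr (n - b))
        = C * 2 powr (n - b) * \<rho> powr (- e - b) * (2 ^ j) powr (- u)"
        using \<rho> by (simp add: u_def powr_mult powr_diff powr_minus powr_add field_simps)
      finally show "ennreal ((2 ^ j * \<rho>) powr (- n - e)) * (\<integral>\<^sup>+y. T j y \<partial>lborel)
        \<le> ennreal (C * 2 powr (n - b) * \<rho> powr (- e - b) * (2 ^ j) powr (- u))" .
    qed
    also have "\<dots> = ennreal (C * 2 powr (n - b) * \<rho> powr (- e - b) / (1 - 2 powr (- u)))"
      using C u by (intro suminf_geometric_powr) auto
    also have "C * 2 powr (n - b) * \<rho> powr (- e - b) / (1 - 2 powr (- u)) = D * \<rho> powr (- e - b)"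
      by (simp add: D_def)
    finally show "(\<integral>\<^sup>+y. (if y \<in> \<Omega> \<and> \<rho> \<le> dist x y then ennreal (dist x y powr (- n - e) * \<delta> y powr (- b)) else 0) \<partial>lborel)
      \<le> ennreal (D * \<rho> powr (- e - b))" .
  qed
qed

end

section \<open>Integration over far pairs\<close>

context uniform_setup
begin

lemma dom_measurable [measurable]: "\<Omega> \<in> sets borel"
  using open_dom by simp

text \<open>For c = \<alpha> + \<beta> this is the intermediate quantity of the proof: it bounds the
  far pairs and is itself bounded by the truncated seminorm in
  \<open>energy_le_truncated\<close>.\<close>

definition energy :: "real \<Rightarrow> ('a \<Rightarrow> real) \<Rightarrow> ennreal" where
  "energy c f = (\<integral>\<^sup>+w. (if w \<in> \<Omega> then ennreal (\<delta> w powr (- c)) * G f w else 0) \<partial>lborel)"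

text \<open>The weighted kernel after absorbing the factor |x - y|^e from \<open>far_pair\<close>,
  which leaves the exponent - n - e.\<close>

definition far_weight :: "real \<Rightarrow> real \<Rightarrow> 'a \<Rightarrow> 'a \<Rightarrow> real" where
  "far_weight a b x y = dist x y powr (- n - e) * \<delta> x powr (- a) * \<delta> y powr (- b)"

lemma far_weight_measurable [measurable (raw)]:
  assumes [measurable]: "f \<in> borel_measurable M" "g \<in> borel_measurable M"
  shows "(\<lambda>z. far_weight a b (f z) (g z)) \<in> borel_measurable M"
  unfolding far_weight_def by measurable

lemma far_weight_nonneg: "0 \<le> far_weight a b x y"
  by (simp add: far_weight_def)

lemma far_weight_commute: "far_weight a b x y = far_weight b a y x"
  by (simp add: far_weight_def dist_commute mult_ac)

lemma shadow_measurable [measurable (raw)]: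
  assumes [measurable]: "nice f" "g \<in> borel_measurable M" "h \<in> borel_measurable M"
  shows "(\<lambda>z. shadow K f (g z) (h z)) \<in> borel_measurable M"
  unfolding shadow_def by measurable

lemma osc_measurable [measurable (raw)]:
  assumes [measurable]: "nice f" "g \<in> borel_measurable M" "h \<in> borel_measurable M"
  shows "(\<lambda>z. osc K f (g z) (h z)) \<in> borel_measurable M"
  unfolding osc_def by measurable

lemma bounded_delta: "\<exists>M>0. \<forall>x\<in>\<Omega>. \<delta> x \<le> M"
proof -
  obtain M where M: "0 < M" "\<And>x y. x \<in> \<Omega> \<Longrightarrow> y \<in> \<Omega> \<Longrightarrow> dist x y \<le> M"
    using bounded_dist by blast
  obtain x0 where x0: "x0 \<in> \<Omega>" using nonempty_dom by auto
  have "\<delta> x \<le> \<delta> x0 + M" if "x \<in> \<Omega>" for x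
    using delta_lipschitz[of x x0] M(2)[OF that x0] by simp
  then show ?thesis
    using M(1) delta_pos[OF x0] by (intro exI[of _ "\<delta> x0 + M"]) auto
qed

text \<open>The factor \<open>G f x\<close> does not involve y. The tail estimate at radius \<tau>
  \<delta> x gives \<delta>(x)^(- e - b), whose e cancels against \<delta>(x)^e.\<close>

lemma local_part:
  assumes a: "admissible a" and b: "admissible b"
  shows "\<exists>C>0. \<forall>f. nice f \<longrightarrow>
    (\<integral>\<^sup>+x. (if x \<in> \<Omega> then (\<integral>\<^sup>+y. (if y \<in> \<Omega> \<and> \<tau> * \<delta> x \<le> dist x y
       then ennreal (far_weight a b x y) * (ennreal (\<delta> x powr e) * G f x) else 0) \<partial>lborel) else 0) \<partial>lborel)
    \<le> ennreal C * energy (a + b) f"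
proof -
  obtain C where C: "0 < C" and tail: "\<And>x \<rho>. x \<in> \<Omega> \<Longrightarrow> 0 < \<rho> \<Longrightarrow> \<delta> x \<le> 1 / \<tau> * \<rho> \<Longrightarrow>
    (\<integral>\<^sup>+y. (if y \<in> \<Omega> \<and> \<rho> \<le> dist x y then ennreal (dist x y powr (- n - e) * \<delta> y powr (- b)) else 0) \<partial>lborel)
      \<le> ennreal (C * \<rho> powr (- e - b))"
    using admissible_tail[OF b, of "1 / \<tau>"] tau by auto
  define D where "D = C * \<tau> powr (- e - b)"
  have D: "0 < D" using C tau by (simp add: D_def)
  show ?thesis
  proof (intro exI[of _ D] conjI D allI impI)
    fix f assume f: "nice f"
    note [measurable] = f
    have "(\<integral>\<^sup>+y. (if y \<in> \<Omega> \<and> \<tau> * \<delta> x \<le> dist x y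
       then ennreal (far_weight a b x y) * (ennreal (\<delta> x powr e) * G f x) else 0) \<partial>lborel)
       \<le> ennreal D * (ennreal (\<delta> x powr (- (a + b))) * G f x)" if x: "x \<in> \<Omega>" for x
    proof -
      have dx: "0 < \<delta> x" using delta_pos[OF x] .
      have "(\<integral>\<^sup>+y. (if y \<in> \<Omega> \<and> \<tau> * \<delta> x \<le> dist x y
       then ennreal (far_weight a b x y) * (ennreal (\<delta> x powr e) * G f x) else 0) \<partial>lborel)
       = (\<integral>\<^sup>+y. (ennreal (\<delta> x powr (- a) * \<delta> x powr e) * G f x) * (if y \<in> \<Omega> \<and> \<tau> * \<delta> x \<le> dist x y
       then ennreal (dist x y powr (- n - e) * \<delta> y powr (- b)) else 0) \<partial>lborel)"
        by (intro nn_integral_cong) (auto simp: far_weight_def ennreal_mult mult_ac)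
      also have "\<dots> = (ennreal (\<delta> x powr (- a) * \<delta> x powr e) * G f x) * (\<integral>\<^sup>+y. (if y \<in> \<Omega> \<and> \<tau> * \<delta> x \<le> dist x y
       then ennreal (dist x y powr (- n - e) * \<delta> y powr (- b)) else 0) \<partial>lborel)"
        by (intro nn_integral_cmult) measurable
      also have "\<dots> \<le> (ennreal (\<delta> x powr (- a) * \<delta> x powr e) * G f x) * ennreal (C * (\<tau> * \<delta> x) powr (- e - b))"
        using tau dx x by (intro mult_left_mono tail) auto
      also have "\<dots> = ennreal (\<delta> x powr (- a) * \<delta> x powr e * (C * (\<tau> * \<delta> x) powr (- e - b))) * G f x"
        using C by (simp add: ennreal_mult mult_ac)
      also have "\<delta> x powr (- a) * \<delta> x powr e * (C * (\<tau> * \<delta> x) powr (- e - b)) = D * \<delta> x powr (- (a + b))"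
        using tau dx by (simp add: D_def powr_mult powr_diff powr_minus powr_add field_simps)
      finally show ?thesis using D by (simp add: ennreal_mult mult_ac)
    qed
    then have "(\<integral>\<^sup>+x. (if x \<in> \<Omega> then (\<integral>\<^sup>+y. (if y \<in> \<Omega> \<and> \<tau> * \<delta> x \<le> dist x y
       then ennreal (far_weight a b x y) * (ennreal (\<delta> x powr e) * G f x) else 0) \<partial>lborel) else 0) \<partial>lborel)
      \<le> (\<integral>\<^sup>+x. ennreal D * (if x \<in> \<Omega> then ennreal (\<delta> x powr (- (a + b))) * G f x else 0) \<partial>lborel)"
      by (intro nn_integral_mono) auto
    also have "\<dots> = ennreal D * energy (a + b) f"
      unfolding energy_def by (intro nn_integral_cmult) measurable
    finally show "(\<integral>\<^sup>+x. (if x \<in> \<Omega> then (\<integral>\<^sup>+y. (if y \<in> \<Omega> \<and> \<tau> * \<delta> x \<le> dist x y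
       then ennreal (far_weight a b x y) * (ennreal (\<delta> x powr e) * G f x) else 0) \<partial>lborel) else 0) \<partial>lborel)
      \<le> ennreal D * energy (a + b) f" .
  qed
qed

text \<open>For fixed w and x, the condition |x - y| \<ge> \<delta> w / K describes a tail in y, of
  size \<delta>(w)^(- e - b). The points x then range over a ball about w of radius comparable to
  \<delta> w and contribute \<delta>(w)^(n - a).\<close>

lemma shadow_kernel:
  assumes a: "admissible a" and b: "admissible b" and K: "1 \<le> K"
  shows "\<exists>C>0. \<forall>w\<in>\<Omega>. (\<integral>\<^sup>+x. (\<integral>\<^sup>+y. (if x \<in> \<Omega> \<and> y \<in> \<Omega> \<and> dist w x \<le> K * \<delta> w \<and> \<delta> w \<le> K * dist x y
      then ennreal (far_weight a b x y) else 0) \<partial>lborel) \<partial>lborel) \<le> ennreal (C * \<delta> w powr (n - e - a - b))"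
proof -
  obtain M where M: "0 < M" "\<And>x. x \<in> \<Omega> \<Longrightarrow> \<delta> x \<le> M"
    using bounded_delta by blast
  have K2: "1 \<le> 2 * K\<^sup>2" using one_le_power[OF K, of 2] by linarith
  obtain CT where CT: "0 < CT" and tail: "\<And>x \<rho>. x \<in> \<Omega> \<Longrightarrow> 0 < \<rho> \<Longrightarrow> \<delta> x \<le> 2 * K\<^sup>2 * \<rho> \<Longrightarrow>
    (\<integral>\<^sup>+y. (if y \<in> \<Omega> \<and> \<rho> \<le> dist x y then ennreal (dist x y powr (- n - e) * \<delta> y powr (- b)) else 0) \<partial>lborel)
      \<le> ennreal (CT * \<rho> powr (- e - b))"
    using admissible_tail[OF b K2] by blast
  obtain CB where CB: "0 < CB" and ball: "\<And>x R. x \<in> \<Omega> \<Longrightarrow> 0 < R \<Longrightarrow> R \<le> 2 * K * M \<Longrightarrow> \<delta> x \<le> 1 * R \<Longrightarrow>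
    (\<integral>\<^sup>+y. (if y \<in> \<Omega> \<and> dist x y < R then ennreal (\<delta> y powr (- a)) else 0) \<partial>lborel)
      \<le> ennreal (CB * R powr (n - a))"
    using admissible_ball[OF a order_refl, of "2 * K * M"] by blast
  define C where "C = CT * K powr (e + b) * (CB * (2 * K) powr (n - a))"
  have C: "0 < C" using CT CB K by (simp add: C_def)
  show ?thesis
  proof (intro exI[of _ C] conjI C ballI)
    fix w assume w: "w \<in> \<Omega>"
    have dw: "0 < \<delta> w" using delta_pos[OF w] .
    have Kw: "1 * \<delta> w \<le> K * \<delta> w" using K dw by (intro mult_right_mono) auto
    let ?\<rho> = "\<delta> w / K"
    have "(\<integral>\<^sup>+x. (\<integral>\<^sup>+y. (if x \<in> \<Omega> \<and> y \<in> \<Omega> \<and> dist w x \<le> K * \<delta> w \<and> \<delta> w \<le> K * dist x y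
      then ennreal (far_weight a b x y) else 0) \<partial>lborel) \<partial>lborel)
      \<le> (\<integral>\<^sup>+x. ennreal (CT * ?\<rho> powr (- e - b)) *
        (if x \<in> \<Omega> \<and> dist w x < 2 * K * \<delta> w then ennreal (\<delta> x powr (- a)) else 0) \<partial>lborel)"
    proof (intro nn_integral_mono)
      fix x
      show "(\<integral>\<^sup>+y. (if x \<in> \<Omega> \<and> y \<in> \<Omega> \<and> dist w x \<le> K * \<delta> w \<and> \<delta> w \<le> K * dist x y
        then ennreal (far_weight a b x y) else 0) \<partial>lborel)
        \<le> ennreal (CT * ?\<rho> powr (- e - b)) *
        (if x \<in> \<Omega> \<and> dist w x < 2 * K * \<delta> w then ennreal (\<delta> x powr (- a)) else 0)"
      proof (cases "x \<in> \<Omega> \<and> dist w x \<le> K * \<delta> w")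
        case True
        have "\<delta> x \<le> 2 * (K * \<delta> w)"
          using delta_lipschitz[of x w] True Kw by (simp add: dist_commute)
        also have "\<dots> = 2 * K\<^sup>2 * ?\<rho>" using K by (simp add: power2_eq_square)
        finally have dx: "\<delta> x \<le> 2 * K\<^sup>2 * ?\<rho>" .
        have "(\<integral>\<^sup>+y. (if x \<in> \<Omega> \<and> y \<in> \<Omega> \<and> dist w x \<le> K * \<delta> w \<and> \<delta> w \<le> K * dist x y
          then ennreal (far_weight a b x y) else 0) \<partial>lborel)
          = (\<integral>\<^sup>+y. ennreal (\<delta> x powr (- a)) * (if y \<in> \<Omega> \<and> ?\<rho> \<le> dist x y
            then ennreal (dist x y powr (- n - e) * \<delta> y powr (- b)) else 0) \<partial>lborel)"
          using True K by (intro nn_integral_cong)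
            (auto simp: far_weight_def ennreal_mult mult_ac pos_divide_le_eq)
        also have "\<dots> = ennreal (\<delta> x powr (- a)) * (\<integral>\<^sup>+y. (if y \<in> \<Omega> \<and> ?\<rho> \<le> dist x y
            then ennreal (dist x y powr (- n - e) * \<delta> y powr (- b)) else 0) \<partial>lborel)"
          by (intro nn_integral_cmult) measurable
        also have "\<dots> \<le> ennreal (\<delta> x powr (- a)) * ennreal (CT * ?\<rho> powr (- e - b))"
          using dx True dw K by (intro mult_left_mono tail) auto
        finally have "(\<integral>\<^sup>+y. (if x \<in> \<Omega> \<and> y \<in> \<Omega> \<and> dist w x \<le> K * \<delta> w \<and> \<delta> w \<le> K * dist x y
          then ennreal (far_weight a b x y) else 0) \<partial>lborel)
          \<le> ennreal (\<delta> x powr (- a)) * ennreal (CT * ?\<rho> powr (- e - b))" .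
        moreover have "dist w x < 2 * K * \<delta> w"
          using True Kw dw unfolding mult.assoc by linarith
        ultimately show ?thesis
          using True by (simp only: if_True simp_thms mult.commute)
      qed auto
    qed
    also have "\<dots> = ennreal (CT * ?\<rho> powr (- e - b)) *
        (\<integral>\<^sup>+x. (if x \<in> \<Omega> \<and> dist w x < 2 * K * \<delta> w then ennreal (\<delta> x powr (- a)) else 0) \<partial>lborel)"
      by (intro nn_integral_cmult) measurable
    also have "\<dots> \<le> ennreal (CT * ?\<rho> powr (- e - b)) * ennreal (CB * (2 * K * \<delta> w) powr (n - a))"
      using K dw w M(2)[OF w] Kw by (intro mult_left_mono ball) auto
    also have "\<dots> = ennreal (CT * ?\<rho> powr (- e - b) * (CB * (2 * K * \<delta> w) powr (n - a)))"
      using CB CT by (simp add: ennreal_mult)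
    also have "CT * ?\<rho> powr (- e - b) * (CB * (2 * K * \<delta> w) powr (n - a)) = C * \<delta> w powr (n - e - a - b)"
      using K dw by (simp add: C_def powr_mult powr_divide powr_diff powr_minus powr_add field_simps)
    finally show "(\<integral>\<^sup>+x. (\<integral>\<^sup>+y. (if x \<in> \<Omega> \<and> y \<in> \<Omega> \<and> dist w x \<le> K * \<delta> w \<and> \<delta> w \<le> K * dist x y
      then ennreal (far_weight a b x y) else 0) \<partial>lborel) \<partial>lborel) \<le> ennreal (C * \<delta> w powr (n - e - a - b))" .
  qed
qed

text \<open>Tonelli's theorem moves the integral defining \<open>shadow\<close> outermost. The
  exponent n - e - a - b from \<open>shadow_kernel\<close> meets e - n from \<open>shadow\<close>,
  leaving - a - b.\<close>

lemma shadow_part: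
  assumes a: "admissible a" and b: "admissible b" and K: "1 \<le> K"
  shows "\<exists>C>0. \<forall>f. nice f \<longrightarrow>
    (\<integral>\<^sup>+x. (if x \<in> \<Omega> then (\<integral>\<^sup>+y. (if y \<in> \<Omega> \<and> \<tau> * \<delta> x \<le> dist x y
       then ennreal (far_weight a b x y) * shadow K f x (dist x y) else 0) \<partial>lborel) else 0) \<partial>lborel)
    \<le> ennreal C * energy (a + b) f"
proof -
  obtain C where C: "0 < C" and ker: "\<And>w. w \<in> \<Omega> \<Longrightarrow>
    (\<integral>\<^sup>+x. (\<integral>\<^sup>+y. (if x \<in> \<Omega> \<and> y \<in> \<Omega> \<and> dist w x \<le> K * \<delta> w \<and> \<delta> w \<le> K * dist x y
      then ennreal (far_weight a b x y) else 0) \<partial>lborel) \<partial>lborel) \<le> ennreal (C * \<delta> w powr (n - e - a - b))"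
    using shadow_kernel[OF assms] by blast
  show ?thesis
  proof (intro exI[of _ C] conjI C allI impI)
    fix f assume f: "nice f"
    note [measurable] = f
    \<comment> \<open>The integrand is split so that \<open>g\<close> depends on w alone and leaves
      the inner integrals; the condition \<tau> \<delta> x \<le> |x - y| is dropped, which only
      enlarges the integral.\<close>
    define I where "I x y w = (if x \<in> \<Omega> \<and> y \<in> \<Omega> \<and> dist w x \<le> K * \<delta> w \<and> \<delta> w \<le> K * dist x y
      then ennreal (far_weight a b x y) else 0)" for x y w
    define g where "g w = (if w \<in> \<Omega> then ennreal (\<delta> w powr (e - n)) * G f w else 0)" for w
    have [measurable (raw)]: "(\<lambda>z. I (h1 z) (h2 z) (h3 z)) \<in> borel_measurable M"
      if [measurable]: "h1 \<in> borel_measurable M" "h2 \<in> borel_measurable M" "h3 \<in> borel_measurable M" for h1 h2 h3 and M :: "'b measure"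
      unfolding I_def by measurable
    have [measurable]: "g \<in> borel_measurable borel"
      unfolding g_def by measurable
    have "(\<integral>\<^sup>+x. (if x \<in> \<Omega> then (\<integral>\<^sup>+y. (if y \<in> \<Omega> \<and> \<tau> * \<delta> x \<le> dist x y
       then ennreal (far_weight a b x y) * shadow K f x (dist x y) else 0) \<partial>lborel) else 0) \<partial>lborel)
      \<le> (\<integral>\<^sup>+x. (\<integral>\<^sup>+y. (\<integral>\<^sup>+w. I x y w * g w \<partial>lborel) \<partial>lborel) \<partial>lborel)"
    proof (intro nn_integral_mono)
      fix x
      have "ennreal (far_weight a b x y) * shadow K f x (dist x y) \<le> (\<integral>\<^sup>+w. I x y w * g w \<partial>lborel)"
        if "x \<in> \<Omega>" "y \<in> \<Omega>" for y
      proof -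
        have "ennreal (far_weight a b x y) * shadow K f x (dist x y)
          = (\<integral>\<^sup>+w. ennreal (far_weight a b x y) * (if w \<in> \<Omega> \<and> dist w x \<le> K * \<delta> w \<and> \<delta> w \<le> K * dist x y
     then ennreal (\<delta> w powr (e - n)) * G f w else 0) \<partial>lborel)"
          unfolding shadow_def by (intro nn_integral_cmult[symmetric]) measurable
        also have "\<dots> \<le> (\<integral>\<^sup>+w. I x y w * g w \<partial>lborel)"
          using that by (intro nn_integral_mono) (auto simp: I_def g_def)
        finally show ?thesis .
      qed
      then show "(if x \<in> \<Omega> then (\<integral>\<^sup>+y. (if y \<in> \<Omega> \<and> \<tau> * \<delta> x \<le> dist x y
       then ennreal (far_weight a b x y) * shadow K f x (dist x y) else 0) \<partial>lborel) else 0)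
       \<le> (\<integral>\<^sup>+y. (\<integral>\<^sup>+w. I x y w * g w \<partial>lborel) \<partial>lborel)"
        by (auto intro!: nn_integral_mono)
    qed
    also have "\<dots> = (\<integral>\<^sup>+x. (\<integral>\<^sup>+w. (\<integral>\<^sup>+y. I x y w * g w \<partial>lborel) \<partial>lborel) \<partial>lborel)"
      by (intro nn_integral_cong lborel_pair.Fubini') measurable
    also have "\<dots> = (\<integral>\<^sup>+w. (\<integral>\<^sup>+x. (\<integral>\<^sup>+y. I x y w * g w \<partial>lborel) \<partial>lborel) \<partial>lborel)"
      by (intro lborel_pair.Fubini') measurable
    also have "\<dots> = (\<integral>\<^sup>+w. (\<integral>\<^sup>+x. (\<integral>\<^sup>+y. I x y w \<partial>lborel) \<partial>lborel) * g w \<partial>lborel)"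
      by (simp add: nn_integral_multc)
    also have "\<dots> \<le> (\<integral>\<^sup>+w. ennreal C * (if w \<in> \<Omega> then ennreal (\<delta> w powr (- (a + b))) * G f w else 0) \<partial>lborel)"
    proof (intro nn_integral_mono)
      fix w
      show "(\<integral>\<^sup>+x. (\<integral>\<^sup>+y. I x y w \<partial>lborel) \<partial>lborel) * g w
        \<le> ennreal C * (if w \<in> \<Omega> then ennreal (\<delta> w powr (- (a + b))) * G f w else 0)"
      proof (cases "w \<in> \<Omega>")
        case True
        have "(\<integral>\<^sup>+x. (\<integral>\<^sup>+y. I x y w \<partial>lborel) \<partial>lborel) * g w \<le> ennreal (C * \<delta> w powr (n - e - a - b)) * g w"
          unfolding I_def by (intro mult_right_mono ker True) auto
        also have "\<dots> = ennreal (C * (\<delta> w powr (n - e - a - b) * \<delta> w powr (e - n))) * G f w"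
          using True C by (simp add: g_def ennreal_mult mult_ac)
        also have "\<delta> w powr (n - e - a - b) * \<delta> w powr (e - n) = \<delta> w powr (- (a + b))"
          unfolding powr_add[symmetric] by (rule arg_cong2[where f = "(powr)"]) auto
        finally show ?thesis using True C by (simp add: ennreal_mult mult_ac)
      qed (simp add: g_def)
    qed
    also have "\<dots> = ennreal C * energy (a + b) f"
      unfolding energy_def by (intro nn_integral_cmult) measurable
    finally show "(\<integral>\<^sup>+x. (if x \<in> \<Omega> then (\<integral>\<^sup>+y. (if y \<in> \<Omega> \<and> \<tau> * \<delta> x \<le> dist x y
       then ennreal (far_weight a b x y) * shadow K f x (dist x y) else 0) \<partial>lborel) else 0) \<partial>lborel)
      \<le> ennreal C * energy (a + b) f" .
  qed
qed

lemma half_far: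
  assumes a: "admissible a" and b: "admissible b" and K: "1 \<le> K"
  shows "\<exists>C>0. \<forall>f. nice f \<longrightarrow>
    (\<integral>\<^sup>+x. (\<integral>\<^sup>+y. (if x \<in> \<Omega> \<and> y \<in> \<Omega> \<and> \<tau> * \<delta> x \<le> dist x y
       then ennreal (far_weight a b x y) * osc K f x (dist x y) else 0) \<partial>lborel) \<partial>lborel)
    \<le> ennreal C * energy (a + b) f"
proof -
  obtain C1 where C1: "0 < C1" and loc: "\<And>f. nice f \<Longrightarrow>
    (\<integral>\<^sup>+x. (if x \<in> \<Omega> then (\<integral>\<^sup>+y. (if y \<in> \<Omega> \<and> \<tau> * \<delta> x \<le> dist x y
       then ennreal (far_weight a b x y) * (ennreal (\<delta> x powr e) * G f x) else 0) \<partial>lborel) else 0) \<partial>lborel)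
    \<le> ennreal C1 * energy (a + b) f"
    using local_part[OF a b] by blast
  obtain C2 where C2: "0 < C2" and sh: "\<And>f. nice f \<Longrightarrow>
    (\<integral>\<^sup>+x. (if x \<in> \<Omega> then (\<integral>\<^sup>+y. (if y \<in> \<Omega> \<and> \<tau> * \<delta> x \<le> dist x y
       then ennreal (far_weight a b x y) * shadow K f x (dist x y) else 0) \<partial>lborel) else 0) \<partial>lborel)
    \<le> ennreal C2 * energy (a + b) f"
    using shadow_part[OF assms] by blast
  show ?thesis
  proof (intro exI[of _ "C1 + C2"] conjI allI impI)
    show "0 < C1 + C2" using C1 C2 by simp
    fix f assume f: "nice f"
    note [measurable] = f
    let ?L = "\<lambda>x y. (if y \<in> \<Omega> \<and> \<tau> * \<delta> x \<le> dist x y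
       then ennreal (far_weight a b x y) * (ennreal (\<delta> x powr e) * G f x) else 0)"
    let ?S = "\<lambda>x y. (if y \<in> \<Omega> \<and> \<tau> * \<delta> x \<le> dist x y
       then ennreal (far_weight a b x y) * shadow K f x (dist x y) else 0)"
    have "(\<integral>\<^sup>+x. (\<integral>\<^sup>+y. (if x \<in> \<Omega> \<and> y \<in> \<Omega> \<and> \<tau> * \<delta> x \<le> dist x y
       then ennreal (far_weight a b x y) * osc K f x (dist x y) else 0) \<partial>lborel) \<partial>lborel)
      = (\<integral>\<^sup>+x. (if x \<in> \<Omega> then (\<integral>\<^sup>+y. ?L x y \<partial>lborel) else 0) + (if x \<in> \<Omega> then (\<integral>\<^sup>+y. ?S x y \<partial>lborel) else 0) \<partial>lborel)"
    proof (intro nn_integral_cong)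
      fix x
      have "(\<integral>\<^sup>+y. ?L x y + ?S x y \<partial>lborel) = (\<integral>\<^sup>+y. ?L x y \<partial>lborel) + (\<integral>\<^sup>+y. ?S x y \<partial>lborel)"
        by (intro nn_integral_add) measurable
      moreover have "(\<integral>\<^sup>+y. (if y \<in> \<Omega> \<and> \<tau> * \<delta> x \<le> dist x y
       then ennreal (far_weight a b x y) * osc K f x (dist x y) else 0) \<partial>lborel) = (\<integral>\<^sup>+y. ?L x y + ?S x y \<partial>lborel)"
        by (intro nn_integral_cong) (simp add: osc_def distrib_left)
      ultimately show "(\<integral>\<^sup>+y. (if x \<in> \<Omega> \<and> y \<in> \<Omega> \<and> \<tau> * \<delta> x \<le> dist x y
       then ennreal (far_weight a b x y) * osc K f x (dist x y) else 0) \<partial>lborel)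
       = (if x \<in> \<Omega> then (\<integral>\<^sup>+y. ?L x y \<partial>lborel) else 0) + (if x \<in> \<Omega> then (\<integral>\<^sup>+y. ?S x y \<partial>lborel) else 0)"
        by simp
    qed
    also have "\<dots> = (\<integral>\<^sup>+x. (if x \<in> \<Omega> then (\<integral>\<^sup>+y. ?L x y \<partial>lborel) else 0) \<partial>lborel)
      + (\<integral>\<^sup>+x. (if x \<in> \<Omega> then (\<integral>\<^sup>+y. ?S x y \<partial>lborel) else 0) \<partial>lborel)"
      by (intro nn_integral_add) measurable
    also have "\<dots> \<le> ennreal C1 * energy (a + b) f + ennreal C2 * energy (a + b) f"
      by (intro add_mono loc sh f)
    also have "\<dots> = ennreal (C1 + C2) * energy (a + b) f"
      using C1 C2 by (simp add: distrib_right)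
    finally show "(\<integral>\<^sup>+x. (\<integral>\<^sup>+y. (if x \<in> \<Omega> \<and> y \<in> \<Omega> \<and> \<tau> * \<delta> x \<le> dist x y
       then ennreal (far_weight a b x y) * osc K f x (dist x y) else 0) \<partial>lborel) \<partial>lborel)
      \<le> ennreal (C1 + C2) * energy (a + b) f" .
  qed
qed

text \<open>The term at y in \<open>far_pair\<close> is the term at x with the variables and the
  exponents a, b exchanged. So \<open>half_far\<close> is used twice, and Tonelli's theorem brings
  the second double integral into its form.\<close>

lemma far_part:
  assumes a: "admissible a" and b: "admissible b"
  shows "\<exists>C>0. \<forall>f. nice f \<longrightarrow>
    (\<integral>\<^sup>+x. (\<integral>\<^sup>+y. (if x \<in> \<Omega> \<and> y \<in> \<Omega> \<and> \<tau> * \<delta> x \<le> dist x y \<and> \<tau> * \<delta> y \<le> dist x y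
       then ennreal (\<bar>f x - f y\<bar> powr p / dist x y powr (n + 2 * e) * \<delta> y powr (- b) * \<delta> x powr (- a)) else 0)
       \<partial>lborel) \<partial>lborel) \<le> ennreal C * energy (a + b) f"
proof -
  obtain A K where A: "0 < A" and K: "1 \<le> K" and far: "\<And>f x y. nice f \<Longrightarrow> x \<in> \<Omega> \<Longrightarrow> y \<in> \<Omega> \<Longrightarrow>
      \<tau> * \<delta> x \<le> dist x y \<Longrightarrow> \<tau> * \<delta> y \<le> dist x y \<Longrightarrow> ennreal (\<bar>f x - f y\<bar> powr p)
        \<le> ennreal (A * dist x y powr e) * (osc K f x (dist x y) + osc K f y (dist x y))"
    using far_pair by blast
  obtain C1 where C1: "0 < C1" and h1: "\<And>f. nice f \<Longrightarrow>
    (\<integral>\<^sup>+x. (\<integral>\<^sup>+y. (if x \<in> \<Omega> \<and> y \<in> \<Omega> \<and> \<tau> * \<delta> x \<le> dist x y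
       then ennreal (far_weight a b x y) * osc K f x (dist x y) else 0) \<partial>lborel) \<partial>lborel)
    \<le> ennreal C1 * energy (a + b) f"
    using half_far[OF a b K] by blast
  obtain C2 where C2: "0 < C2" and h2: "\<And>f. nice f \<Longrightarrow>
    (\<integral>\<^sup>+x. (\<integral>\<^sup>+y. (if x \<in> \<Omega> \<and> y \<in> \<Omega> \<and> \<tau> * \<delta> x \<le> dist x y
       then ennreal (far_weight b a x y) * osc K f x (dist x y) else 0) \<partial>lborel) \<partial>lborel)
    \<le> ennreal C2 * energy (b + a) f"
    using half_far[OF b a K] by blast
  define C where "C = A * (C1 + C2)"
  have C: "0 < C" using A C1 C2 by (simp add: C_def)
  show ?thesis
  proof (intro exI[of _ C] conjI C allI impI)
    fix f assume f: "nice f"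
    note [measurable] = f
    define P where "P x y = (if x \<in> \<Omega> \<and> y \<in> \<Omega> \<and> \<tau> * \<delta> x \<le> dist x y
       then ennreal (far_weight a b x y) * osc K f x (dist x y) else 0)" for x y
    define Q where "Q x y = (if x \<in> \<Omega> \<and> y \<in> \<Omega> \<and> \<tau> * \<delta> x \<le> dist x y
       then ennreal (far_weight b a x y) * osc K f x (dist x y) else 0)" for x y
    have [measurable (raw)]: "(\<lambda>z. P (h1 z) (h2 z)) \<in> borel_measurable M" "(\<lambda>z. Q (h1 z) (h2 z)) \<in> borel_measurable M"
      if [measurable]: "h1 \<in> borel_measurable M" "h2 \<in> borel_measurable M" for h1 h2 and M :: "'b measure"
      unfolding P_def Q_def by measurable
    have "(\<integral>\<^sup>+x. (\<integral>\<^sup>+y. (if x \<in> \<Omega> \<and> y \<in> \<Omega> \<and> \<tau> * \<delta> x \<le> dist x y \<and> \<tau> * \<delta> y \<le> dist x y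
       then ennreal (\<bar>f x - f y\<bar> powr p / dist x y powr (n + 2 * e) * \<delta> y powr (- b) * \<delta> x powr (- a)) else 0)
       \<partial>lborel) \<partial>lborel) \<le> (\<integral>\<^sup>+x. (\<integral>\<^sup>+y. ennreal A * (P x y + Q y x) \<partial>lborel) \<partial>lborel)"
    proof (intro nn_integral_mono)
      fix x y
      show "(if x \<in> \<Omega> \<and> y \<in> \<Omega> \<and> \<tau> * \<delta> x \<le> dist x y \<and> \<tau> * \<delta> y \<le> dist x y
       then ennreal (\<bar>f x - f y\<bar> powr p / dist x y powr (n + 2 * e) * \<delta> y powr (- b) * \<delta> x powr (- a)) else 0)
       \<le> ennreal A * (P x y + Q y x)"
      proof (cases "x \<in> \<Omega> \<and> y \<in> \<Omega> \<and> \<tau> * \<delta> x \<le> dist x y \<and> \<tau> * \<delta> y \<le> dist x y")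
        case True
        have "0 < \<tau> * \<delta> x" using True delta_pos tau by auto
        then have D: "0 < dist x y" using True by linarith
        let ?w = "dist x y powr (- n - 2 * e) * \<delta> y powr (- b) * \<delta> x powr (- a)"
        have "\<bar>f x - f y\<bar> powr p / dist x y powr (n + 2 * e) * \<delta> y powr (- b) * \<delta> x powr (- a)
          = ?w * \<bar>f x - f y\<bar> powr p"
          using D by (simp add: powr_add powr_diff powr_minus field_simps)
        then have "ennreal (\<bar>f x - f y\<bar> powr p / dist x y powr (n + 2 * e) * \<delta> y powr (- b) * \<delta> x powr (- a))
          = ennreal ?w * ennreal (\<bar>f x - f y\<bar> powr p)"
          by (simp add: ennreal_mult')
        also have "\<dots> \<le> ennreal ?w * (ennreal (A * dist x y powr e) * (osc K f x (dist x y) + osc K f y (dist x y)))"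
          using True by (intro mult_left_mono far f) auto
        also have "\<dots> = ennreal (?w * (A * dist x y powr e)) * (osc K f x (dist x y) + osc K f y (dist x y))"
          using A by (subst ennreal_mult) (auto simp: mult.assoc)
        also have "?w * (A * dist x y powr e)
          = A * (dist x y powr (- n - 2 * e) * dist x y powr e * \<delta> x powr (- a) * \<delta> y powr (- b))"
          by (simp add: mult_ac)
        also have "dist x y powr (- n - 2 * e) * dist x y powr e = dist x y powr (- n - e)"
          unfolding powr_add[symmetric] by (rule arg_cong2[where f = "(powr)"]) auto
        also have "A * (dist x y powr (- n - e) * \<delta> x powr (- a) * \<delta> y powr (- b)) = A * far_weight a b x y"
          by (simp add: far_weight_def)
        also have "ennreal (A * far_weight a b x y) * (osc K f x (dist x y) + osc K f y (dist x y))
          = ennreal A * (P x y + Q y x)"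
          using True A far_weight_nonneg
          by (simp add: P_def Q_def ennreal_mult' mult.assoc distrib_left far_weight_commute[of b a y x] dist_commute)
        finally show ?thesis using True by simp
      qed auto
    qed
    also have "\<dots> = (\<integral>\<^sup>+x. ennreal A * ((\<integral>\<^sup>+y. P x y \<partial>lborel) + (\<integral>\<^sup>+y. Q y x \<partial>lborel)) \<partial>lborel)"
      by (simp add: nn_integral_cmult nn_integral_add)
    also have "\<dots> = ennreal A * ((\<integral>\<^sup>+x. (\<integral>\<^sup>+y. P x y \<partial>lborel) \<partial>lborel) + (\<integral>\<^sup>+x. (\<integral>\<^sup>+y. Q y x \<partial>lborel) \<partial>lborel))"
      by (simp add: nn_integral_cmult nn_integral_add)
    also have "(\<integral>\<^sup>+x. (\<integral>\<^sup>+y. Q y x \<partial>lborel) \<partial>lborel) = (\<integral>\<^sup>+y. (\<integral>\<^sup>+x. Q y x \<partial>lborel) \<partial>lborel)"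
      by (intro lborel_pair.Fubini') measurable
    also have "ennreal A * ((\<integral>\<^sup>+x. (\<integral>\<^sup>+y. P x y \<partial>lborel) \<partial>lborel) + \<dots>)
      \<le> ennreal A * (ennreal C1 * energy (a + b) f + ennreal C2 * energy (b + a) f)"
      unfolding P_def Q_def by (intro mult_left_mono add_mono h1 h2 f) auto
    also have "\<dots> = ennreal C * energy (a + b) f"
      using A C1 C2 by (simp add: C_def ennreal_mult' distrib_right distrib_left add.commute mult.assoc)
    finally show "(\<integral>\<^sup>+x. (\<integral>\<^sup>+y. (if x \<in> \<Omega> \<and> y \<in> \<Omega> \<and> \<tau> * \<delta> x \<le> dist x y \<and> \<tau> * \<delta> y \<le> dist x y
       then ennreal (\<bar>f x - f y\<bar> powr p / dist x y powr (n + 2 * e) * \<delta> y powr (- b) * \<delta> x powr (- a)) else 0)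
       \<partial>lborel) \<partial>lborel) \<le> ennreal C * energy (a + b) f" .
  qed
qed

end

section \<open>Reduction to Borel functions\<close>

context uniform_setup
begin

lemma gagliardo_kernel_eq:
  "s * p = 2 * e \<Longrightarrow> gagliardo_kernel \<Omega> s p a b f x y
    = \<bar>f x - f y\<bar> powr p / dist x y powr (n + 2 * e) * \<delta> y powr (- b) * \<delta> x powr (- a)"
  by (simp add: gagliardo_kernel_def n_eq)

text \<open>Completing a measure does not change the nonnegative integral of any integrand,
  measurable or not, so \<open>lebesgue\<close> may be replaced by \<open>lborel\<close>.\<close>

lemma gagliardo_truncated_eq:
  assumes "s * p = 2 * e"
  shows "gagliardo_truncated \<Omega> \<theta> s p a b f = (\<integral>\<^sup>+x. (if x \<in> \<Omega> then (\<integral>\<^sup>+y. (if dist x y < \<theta> * \<delta> x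
    then ennreal (\<bar>f x - f y\<bar> powr p / dist x y powr (n + 2 * e) * \<delta> y powr (- b) * \<delta> x powr (- a)) else 0)
    \<partial>lborel) else 0) \<partial>lborel)"
  unfolding gagliardo_truncated_def nn_integral_completion gagliardo_kernel_eq[OF assms]
  by (intro nn_integral_cong) (auto split: split_indicator intro!: nn_integral_cong)

lemma gagliardo_full_eq:
  assumes "s * p = 2 * e"
  shows "gagliardo_full \<Omega> s p a b f = (\<integral>\<^sup>+x. (if x \<in> \<Omega> then (\<integral>\<^sup>+y. (if y \<in> \<Omega>
    then ennreal (\<bar>f x - f y\<bar> powr p / dist x y powr (n + 2 * e) * \<delta> y powr (- b) * \<delta> x powr (- a)) else 0)
    \<partial>lborel) else 0) \<partial>lborel)"
  unfolding gagliardo_full_def nn_integral_completion gagliardo_kernel_eq[OF assms]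
  by (intro nn_integral_cong) (auto split: split_indicator intro!: nn_integral_cong)

text \<open>In the range of \<open>G\<close> one has \<delta> y \<le> 2 \<delta> x, so moving the
  weight of exponent b from x to y costs at most 2^b. Doubling the radius only increases the right
  side.\<close>

lemma energy_le_truncated:
  assumes f: "nice f" and b: "0 \<le> b" and sp: "s * p = 2 * e"
  shows "energy (a + b) f \<le> ennreal (2 powr b) * gagliardo_truncated \<Omega> (2 * \<tau>) s p a b f"
proof -
  note [measurable] = niceD[OF f]
  let ?k = "\<lambda>x y. \<bar>f x - f y\<bar> powr p / dist x y powr (n + 2 * e)"
  have "energy (a + b) f \<le> (\<integral>\<^sup>+x. ennreal (2 powr b) * (if x \<in> \<Omega> then (\<integral>\<^sup>+y. (if dist x y < 2 * \<tau> * \<delta> x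
    then ennreal (?k x y * \<delta> y powr (- b) * \<delta> x powr (- a)) else 0) \<partial>lborel) else 0) \<partial>lborel)"
    unfolding energy_def
  proof (intro nn_integral_mono)
    fix x
    show "(if x \<in> \<Omega> then ennreal (\<delta> x powr (- (a + b))) * G f x else 0)
      \<le> ennreal (2 powr b) * (if x \<in> \<Omega> then (\<integral>\<^sup>+y. (if dist x y < 2 * \<tau> * \<delta> x
      then ennreal (?k x y * \<delta> y powr (- b) * \<delta> x powr (- a)) else 0) \<partial>lborel) else 0)"
    proof (cases "x \<in> \<Omega>")
      case True
      have dx: "0 < \<delta> x" using delta_pos[OF True] .
      have tx: "\<tau> * \<delta> x \<le> 1 / 2 * \<delta> x" "0 < \<tau> * \<delta> x"
        using tau dx by (auto intro!: mult_right_mono)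
      have "ennreal (\<delta> x powr (- (a + b))) * G f x
        = (\<integral>\<^sup>+y. ennreal (\<delta> x powr (- (a + b))) * (if dist x y < \<tau> * \<delta> x then ennreal (?k x y) else 0) \<partial>lborel)"
        unfolding G_def by (intro nn_integral_cmult[symmetric]) measurable
      also have "\<dots> \<le> (\<integral>\<^sup>+y. ennreal (2 powr b) * (if dist x y < 2 * \<tau> * \<delta> x
        then ennreal (?k x y * \<delta> y powr (- b) * \<delta> x powr (- a)) else 0) \<partial>lborel)"
      proof (intro nn_integral_mono)
        fix y
        show "ennreal (\<delta> x powr (- (a + b))) * (if dist x y < \<tau> * \<delta> x then ennreal (?k x y) else 0)
          \<le> ennreal (2 powr b) * (if dist x y < 2 * \<tau> * \<delta> x
            then ennreal (?k x y * \<delta> y powr (- b) * \<delta> x powr (- a)) else 0)"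
        proof (cases "dist x y < \<tau> * \<delta> x")
          case xy: True
          have dy: "0 < \<delta> y" "\<delta> y \<le> 2 * \<delta> x"
            using delta_lipschitz[of x y] delta_lipschitz[of y x, unfolded dist_commute[of y x]] xy tx dx
            by linarith+
          have "(2 * \<delta> x) powr (- b) \<le> \<delta> y powr (- b)"
            using dy b by (intro powr_mono2') auto
          then have "2 powr b * (2 powr (- b) * \<delta> x powr (- b)) \<le> 2 powr b * \<delta> y powr (- b)"
            using dx by (intro mult_left_mono) (auto simp: powr_mult)
          then have "\<delta> x powr (- b) \<le> 2 powr b * \<delta> y powr (- b)"
            by (simp add: powr_minus field_simps)
          then have "?k x y * \<delta> x powr (- a) * \<delta> x powr (- b) \<le> ?k x y * \<delta> x powr (- a) * (2 powr b * \<delta> y powr (- b))"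
            by (intro mult_left_mono) auto
          moreover have "\<delta> x powr (- (a + b)) = \<delta> x powr (- a) * \<delta> x powr (- b)"
            unfolding powr_add[symmetric] by (rule arg_cong2[where f = "(powr)"]) auto
          ultimately have "\<delta> x powr (- (a + b)) * ?k x y \<le> 2 powr b * (?k x y * \<delta> y powr (- b) * \<delta> x powr (- a))"
            by (simp only: mult_ac)
          then have "ennreal (\<delta> x powr (- (a + b)) * ?k x y) \<le> ennreal (2 powr b * (?k x y * \<delta> y powr (- b) * \<delta> x powr (- a)))"
            by (rule ennreal_leI)
          moreover have "dist x y < 2 * \<tau> * \<delta> x" using xy tx by linarith
          ultimately show ?thesis
            using xy by (simp add: ennreal_mult'[symmetric])
        qed simp
      qed
      also have "\<dots> = ennreal (2 powr b) * (\<integral>\<^sup>+y. (if dist x y < 2 * \<tau> * \<delta> x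
        then ennreal (?k x y * \<delta> y powr (- b) * \<delta> x powr (- a)) else 0) \<partial>lborel)"
        by (intro nn_integral_cmult) measurable
      finally show ?thesis using True by simp
    qed simp
  qed
  also have "\<dots> = ennreal (2 powr b) * gagliardo_truncated \<Omega> (2 * \<tau>) s p a b f"
    unfolding gagliardo_truncated_eq[OF sp] by (intro nn_integral_cmult) measurable
  finally show ?thesis .
qed

text \<open>If |x - y| \<ge> 2 \<tau> \<delta> x, then \<tau> \<delta> y \<le> \<tau> \<delta> x +
  \<tau> |x - y| \<le> |x - y| because \<tau> \<le> 1 / 2, so the pair is far as seen from both
  points. This is the reason for halving \<theta>; all other pairs are counted in the truncated
  seminorm.\<close>

lemma full_le_truncated:
  assumes a: "admissible a" and b: "admissible b" and sp: "s * p = 2 * e"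
  shows "\<exists>C>0. \<forall>f. nice f \<longrightarrow>
    gagliardo_full \<Omega> s p a b f \<le> ennreal C * gagliardo_truncated \<Omega> (2 * \<tau>) s p a b f"
proof -
  obtain A where A: "0 < A" and far: "\<And>f. nice f \<Longrightarrow>
    (\<integral>\<^sup>+x. (\<integral>\<^sup>+y. (if x \<in> \<Omega> \<and> y \<in> \<Omega> \<and> \<tau> * \<delta> x \<le> dist x y \<and> \<tau> * \<delta> y \<le> dist x y
       then ennreal (\<bar>f x - f y\<bar> powr p / dist x y powr (n + 2 * e) * \<delta> y powr (- b) * \<delta> x powr (- a)) else 0)
       \<partial>lborel) \<partial>lborel) \<le> ennreal A * energy (a + b) f"
    using far_part[OF a b] by blast
  have b0: "0 \<le> b" using b by (simp add: admissible_def)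
  define C where "C = 1 + A * 2 powr b"
  have C: "0 < C" using A by (simp add: C_def add_pos_pos)
  show ?thesis
  proof (intro exI[of _ C] conjI C allI impI)
    fix f assume f: "nice f"
    note [measurable] = niceD[OF f]
    define k where "k x y = ennreal (\<bar>f x - f y\<bar> powr p / dist x y powr (n + 2 * e) * \<delta> y powr (- b) * \<delta> x powr (- a))" for x y
    have [measurable (raw)]: "(\<lambda>z. k (h1 z) (h2 z)) \<in> borel_measurable M"
      if [measurable]: "h1 \<in> borel_measurable M" "h2 \<in> borel_measurable M" for h1 h2 and M :: "'b measure"
      unfolding k_def by measurable
    let ?T = "gagliardo_truncated \<Omega> (2 * \<tau>) s p a b f"
    let ?N = "\<lambda>x y. if x \<in> \<Omega> \<and> dist x y < 2 * \<tau> * \<delta> x then k x y else 0"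
    let ?F = "\<lambda>x y. if x \<in> \<Omega> \<and> y \<in> \<Omega> \<and> \<tau> * \<delta> x \<le> dist x y \<and> \<tau> * \<delta> y \<le> dist x y then k x y else 0"
    have "gagliardo_full \<Omega> s p a b f \<le> (\<integral>\<^sup>+x. (\<integral>\<^sup>+y. ?N x y + ?F x y \<partial>lborel) \<partial>lborel)"
      unfolding gagliardo_full_eq[OF sp] k_def[symmetric]
    proof (intro nn_integral_mono)
      fix x
      have "k x y \<le> ?N x y + ?F x y" if x: "x \<in> \<Omega>" and y: "y \<in> \<Omega>" for y
      proof (cases "dist x y < 2 * \<tau> * \<delta> x")
        case False
        have dx: "0 < \<tau> * \<delta> x" using delta_pos[OF x] tau by simp
        have "\<tau> * \<delta> y \<le> \<tau> * \<delta> x + \<tau> * dist x y"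
          using mult_left_mono[OF delta_lipschitz[of y x], of \<tau>] tau
          by (simp add: dist_commute distrib_left)
        moreover have "\<tau> * dist x y \<le> 1 / 2 * dist x y"
          using tau by (intro mult_right_mono) auto
        moreover have "2 * (\<tau> * \<delta> x) \<le> dist x y" using False by simp
        ultimately have "\<tau> * \<delta> x \<le> dist x y" "\<tau> * \<delta> y \<le> dist x y"
          using dx by linarith+
        then show ?thesis using x y by auto
      qed (use x in simp)
      then show "(if x \<in> \<Omega> then (\<integral>\<^sup>+y. (if y \<in> \<Omega> then k x y else 0) \<partial>lborel) else 0)
        \<le> (\<integral>\<^sup>+y. ?N x y + ?F x y \<partial>lborel)"
        by (auto intro!: nn_integral_mono)
    qed
    also have "\<dots> = (\<integral>\<^sup>+x. (\<integral>\<^sup>+y. ?N x y \<partial>lborel) + (\<integral>\<^sup>+y. ?F x y \<partial>lborel) \<partial>lborel)"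
      by (intro nn_integral_cong nn_integral_add) measurable
    also have "\<dots> = (\<integral>\<^sup>+x. (\<integral>\<^sup>+y. ?N x y \<partial>lborel) \<partial>lborel) + (\<integral>\<^sup>+x. (\<integral>\<^sup>+y. ?F x y \<partial>lborel) \<partial>lborel)"
      by (intro nn_integral_add) measurable
    also have "(\<integral>\<^sup>+x. (\<integral>\<^sup>+y. ?N x y \<partial>lborel) \<partial>lborel) = ?T"
      unfolding gagliardo_truncated_eq[OF sp] k_def[symmetric] by (intro nn_integral_cong) auto
    also have "(\<integral>\<^sup>+x. (\<integral>\<^sup>+y. ?F x y \<partial>lborel) \<partial>lborel) \<le> ennreal A * (ennreal (2 powr b) * ?T)"
      unfolding k_def using far[OF f] energy_le_truncated[OF f b0 sp, of a]
      by (meson order_trans mult_left_mono zero_le)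
    also have "?T + ennreal A * (ennreal (2 powr b) * ?T) = ennreal C * ?T"
      using A by (simp add: C_def ennreal_mult distrib_right mult.assoc)
    finally show "gagliardo_full \<Omega> s p a b f \<le> ennreal C * ?T"
      by (simp add: add_left_mono)
  qed
qed

text \<open>The extension of f by 0 outside \<Omega> is the pointwise limit of its restrictions to a
  compact exhaustion, hence Lebesgue measurable, and it agrees almost everywhere with a Borel
  function g.\<close>

lemma L1_loc_nice:
  assumes f: "L1_loc \<Omega> f"
  obtains g where "nice g" "AE x in lborel. x \<in> \<Omega> \<longrightarrow> f x = g x"
proof -
  obtain K :: "nat \<Rightarrow> 'a set" where K: "\<And>i. compact (K i)" "\<And>i. K i \<subseteq> \<Omega>"
    and ev: "\<And>L. compact L \<Longrightarrow> L \<subseteq> \<Omega> \<Longrightarrow> \<exists>N. \<forall>i\<ge>N. L \<subseteq> K i"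
    using open_Union_compact_subsets[OF open_dom] by metis
  have meas: "(\<lambda>x. indicator \<Omega> x * f x) \<in> borel_measurable lebesgue"
  proof (rule borel_measurable_LIMSEQ_real)
    show "(\<lambda>x. indicator (K i) x * f x) \<in> borel_measurable lebesgue" for i
      using f K unfolding L1_loc_def set_integrable_def by (auto dest: borel_measurable_integrable)
    fix x
    show "(\<lambda>i. indicator (K i) x * f x) \<longlonglongrightarrow> indicator \<Omega> x * f x"
    proof (cases "x \<in> \<Omega>")
      case True
      then obtain N where "\<forall>i\<ge>N. {x} \<subseteq> K i" using ev[of "{x}"] by auto
      then have "\<forall>\<^sub>F i in sequentially. indicator (K i) x * f x = indicator \<Omega> x * f x"
        using True by (auto simp: eventually_sequentially intro!: exI[of _ N])
      then show ?thesis by (rule tendsto_eventually)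
    next
      case False
      then have "x \<notin> K i" for i using K by auto
      then show ?thesis using False by simp
    qed
  qed
  then obtain g where "g \<in> borel_measurable lborel"
    and ae: "AE x in lborel. indicator \<Omega> x * f x = g x"
    using completion_ex_borel_measurable_real by blast
  then have g [measurable]: "g \<in> borel_measurable borel" by simp
  have ae': "AE x in lborel. x \<in> \<Omega> \<longrightarrow> f x = g x"
    using ae by eventually_elim auto
  have "set_integrable lborel (ball x r) g" if "cball x r \<subseteq> \<Omega>" for x r
  proof -
    have gm: "(\<lambda>y. indicator (ball x r) y *\<^sub>R g y) \<in> borel_measurable lborel"
      by (intro borel_measurable_scaleR borel_measurable_indicator) (use g in simp_all)
    have "f absolutely_integrable_on cball x r"
      using f that by (simp add: L1_loc_def)
    then have "set_integrable lebesgue (ball x r) f"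
      by (rule set_integrable_subset) auto
    then have "integrable lebesgue (\<lambda>y. indicator (ball x r) y *\<^sub>R f y)"
      by (simp add: set_integrable_def)
    then have "integrable lebesgue (\<lambda>y. indicator (ball x r) y *\<^sub>R g y)"
    proof (rule integrable_cong_AE_imp)
      show "(\<lambda>y. indicator (ball x r) y *\<^sub>R g y) \<in> borel_measurable lebesgue"
        by (rule measurable_completion[OF gm])
      show "AE y in lebesgue. indicator (ball x r) y *\<^sub>R f y = indicator (ball x r) y *\<^sub>R g y"
        using AE_completion[OF ae']
      proof eventually_elim
        fix y assume "y \<in> \<Omega> \<longrightarrow> f y = g y"
        moreover have "y \<in> \<Omega>" if "y \<in> ball x r"
          using that \<open>cball x r \<subseteq> \<Omega>\<close> ball_subset_cball by blast
        ultimately show "indicator (ball x r) y *\<^sub>R f y = indicator (ball x r) y *\<^sub>R g y"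
          by (auto split: split_indicator)
      qed
    qed
    then show ?thesis
      unfolding set_integrable_def by (subst (asm) integrable_completion[OF gm])
  qed
  then have "nice g" using g by (simp add: nice_def)
  then show thesis using ae' that by blast
qed

text \<open>The exceptional null set is discarded twice: for the outer variable, and for the inner
  one with x fixed outside it.\<close>

lemma gagliardo_full_cong_AE:
  assumes ae: "AE x in lborel. x \<in> \<Omega> \<longrightarrow> f x = g x"
  shows "gagliardo_full \<Omega> s p a b f = gagliardo_full \<Omega> s p a b g"
  unfolding gagliardo_full_def
proof (intro nn_integral_cong_AE)
  show "AE x in lebesgue.
      (\<integral>\<^sup>+y\<in>\<Omega>. ennreal (gagliardo_kernel \<Omega> s p a b f x y) \<partial>lebesgue) * indicator \<Omega> x =
      (\<integral>\<^sup>+y\<in>\<Omega>. ennreal (gagliardo_kernel \<Omega> s p a b g x y) \<partial>lebesgue) * indicator \<Omega> x"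
    using AE_completion[OF ae]
  proof eventually_elim
    fix x assume x: "x \<in> \<Omega> \<longrightarrow> f x = g x"
    have "(\<integral>\<^sup>+y\<in>\<Omega>. ennreal (gagliardo_kernel \<Omega> s p a b f x y) \<partial>lebesgue) =
      (\<integral>\<^sup>+y\<in>\<Omega>. ennreal (gagliardo_kernel \<Omega> s p a b g x y) \<partial>lebesgue)" if "x \<in> \<Omega>"
    proof (intro nn_integral_cong_AE)
      show "AE y in lebesgue. ennreal (gagliardo_kernel \<Omega> s p a b f x y) * indicator \<Omega> y =
        ennreal (gagliardo_kernel \<Omega> s p a b g x y) * indicator \<Omega> y"
        using AE_completion[OF ae] x that
        by (auto elim!: eventually_mono simp: gagliardo_kernel_def split: split_indicator)
    qed
    then show "(\<integral>\<^sup>+y\<in>\<Omega>. ennreal (gagliardo_kernel \<Omega> s p a b f x y) \<partial>lebesgue) * indicator \<Omega> x =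
      (\<integral>\<^sup>+y\<in>\<Omega>. ennreal (gagliardo_kernel \<Omega> s p a b g x y) \<partial>lebesgue) * indicator \<Omega> x"
      by (auto split: split_indicator)
  qed
qed

text \<open>The bound \<theta> \<le> 1 keeps the inner ball inside \<Omega>, where f and g agree
  almost everywhere.\<close>

lemma gagliardo_truncated_cong_AE:
  assumes ae: "AE x in lborel. x \<in> \<Omega> \<longrightarrow> f x = g x" and \<theta>: "\<theta> \<le> 1"
  shows "gagliardo_truncated \<Omega> \<theta> s p a b f = gagliardo_truncated \<Omega> \<theta> s p a b g"
  unfolding gagliardo_truncated_def
proof (intro nn_integral_cong_AE)
  show "AE x in lebesgue.
      (\<integral>\<^sup>+y\<in>ball x (\<theta> * \<delta> x). ennreal (gagliardo_kernel \<Omega> s p a b f x y) \<partial>lebesgue) * indicator \<Omega> x =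
      (\<integral>\<^sup>+y\<in>ball x (\<theta> * \<delta> x). ennreal (gagliardo_kernel \<Omega> s p a b g x y) \<partial>lebesgue) * indicator \<Omega> x"
    using AE_completion[OF ae]
  proof eventually_elim
    fix x assume x: "x \<in> \<Omega> \<longrightarrow> f x = g x"
    have "(\<integral>\<^sup>+y\<in>ball x (\<theta> * \<delta> x). ennreal (gagliardo_kernel \<Omega> s p a b f x y) \<partial>lebesgue) =
      (\<integral>\<^sup>+y\<in>ball x (\<theta> * \<delta> x). ennreal (gagliardo_kernel \<Omega> s p a b g x y) \<partial>lebesgue)" if "x \<in> \<Omega>"
    proof (intro nn_integral_cong_AE)
      have "ball x (\<theta> * \<delta> x) \<subseteq> \<Omega>" using ball_bdist_subset[OF that \<theta>] .
      then show "AE y in lebesgue. ennreal (gagliardo_kernel \<Omega> s p a b f x y) * indicator (ball x (\<theta> * \<delta> x)) y =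
        ennreal (gagliardo_kernel \<Omega> s p a b g x y) * indicator (ball x (\<theta> * \<delta> x)) y"
        using AE_completion[OF ae] x that
        by (auto elim!: eventually_mono simp: gagliardo_kernel_def split: split_indicator)
    qed
    then show "(\<integral>\<^sup>+y\<in>ball x (\<theta> * \<delta> x). ennreal (gagliardo_kernel \<Omega> s p a b f x y) \<partial>lebesgue) * indicator \<Omega> x =
      (\<integral>\<^sup>+y\<in>ball x (\<theta> * \<delta> x). ennreal (gagliardo_kernel \<Omega> s p a b g x y) \<partial>lebesgue) * indicator \<Omega> x"
      by (auto split: split_indicator)
  qed
qed

end

theorem theorem2:
  fixes \<Omega> :: "'a::euclidean_space set"
    and s p \<theta> \<alpha> \<beta> :: real
  assumes "\<Omega> \<noteq> {}" and "bounded \<Omega>" and "uniform_domain \<Omega>"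
    and "0 < s" and "s < 1"
    and "1 \<le> p"
    and "0 < \<theta>" and "\<theta> \<le> 1"
    and "0 \<le> \<alpha>" and "ereal \<alpha> < lower_assouad_codim (frontier \<Omega>)"
    and "0 \<le> \<beta>" and "ereal \<beta> < lower_assouad_codim (frontier \<Omega>)"
  shows "\<exists>C::real. C > 0 \<and>
    (\<forall>f. L1_loc \<Omega> f \<longrightarrow>
      gagliardo_full \<Omega> s p \<alpha> \<beta> f \<le> ennreal C * gagliardo_truncated \<Omega> \<theta> s p \<alpha> \<beta> f)"
proof -
  have op: "open \<Omega>"
    using assms(3) by (simp add: uniform_domain_def)
  have "\<exists>C\<ge>1. \<forall>x\<in>\<Omega>. \<forall>y\<in>\<Omega>. \<exists>\<gamma> l.
        arc_length_param \<gamma> l \<and> \<gamma> ` {0..l} \<subseteq> \<Omega> \<and> \<gamma> 0 = x \<and> \<gamma> l = y \<and>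
        l \<le> C * dist x y \<and>
        (\<forall>z \<in> \<gamma> ` {0..l}. bdist \<Omega> z \<ge> 1 / C * min (dist z x) (dist z y))"
    using assms(3) unfolding uniform_domain_def by (elim conjE)
  then obtain C0 where C0: "1 \<le> C0" and curve: "\<forall>x\<in>\<Omega>. \<forall>y\<in>\<Omega>. \<exists>\<gamma> l.
        arc_length_param \<gamma> l \<and> \<gamma> ` {0..l} \<subseteq> \<Omega> \<and> \<gamma> 0 = x \<and> \<gamma> l = y \<and>
        l \<le> C0 * dist x y \<and>
        (\<forall>z \<in> \<gamma> ` {0..l}. bdist \<Omega> z \<ge> 1 / C0 * min (dist z x) (dist z y))"
    by (elim exE conjE)
  \<comment> \<open>With \<tau> = \<theta> / 2 the radius 2 \<tau> \<delta> x in
    \<open>full_le_truncated\<close> is the given one. Only half of s p serves as e, since the other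
    half is spent on summing the scales.\<close>
  interpret uniform_setup \<Omega> C0 "s * p / 2" "\<theta> / 2" p "real DIM('a)"
  proof
    fix x y assume xy: "x \<in> \<Omega>" "y \<in> \<Omega>"
    obtain \<gamma> l where \<gamma>: "arc_length_param \<gamma> l" "\<gamma> ` {0..l} \<subseteq> \<Omega>" "\<gamma> 0 = x" "\<gamma> l = y" "l \<le> C0 * dist x y"
      and unif: "\<forall>z \<in> \<gamma> ` {0..l}. bdist \<Omega> z \<ge> 1 / C0 * min (dist z x) (dist z y)"
      using bspec[OF bspec[OF curve xy(1)] xy(2)] by (elim exE conjE)
    have "min (dist (\<gamma> t) x) (dist (\<gamma> t) y) \<le> C0 * bdist \<Omega> (\<gamma> t)" if "t \<in> {0..l}" for t
    proof -
      have "1 / C0 * min (dist (\<gamma> t) x) (dist (\<gamma> t) y) \<le> bdist \<Omega> (\<gamma> t)"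
        using unif that by blast
      then have "C0 * (1 / C0 * min (dist (\<gamma> t) x) (dist (\<gamma> t) y)) \<le> C0 * bdist \<Omega> (\<gamma> t)"
        using C0 by (intro mult_left_mono) auto
      then show ?thesis using C0 by simp
    qed
    then show "\<exists>\<gamma> l. 0 \<le> l \<and> continuous_on {0..l} \<gamma> \<and>
      \<gamma> ` {0..l} \<subseteq> \<Omega> \<and> \<gamma> 0 = x \<and> \<gamma> l = y \<and> l \<le> C0 * dist x y \<and>
      (\<forall>a b. 0 \<le> a \<longrightarrow> a \<le> b \<longrightarrow> b \<le> l \<longrightarrow> dist (\<gamma> a) (\<gamma> b) \<le> b - a) \<and>
      (\<forall>t\<in>{0..l}. min (dist (\<gamma> t) x) (dist (\<gamma> t) y) \<le> C0 * bdist \<Omega> (\<gamma> t))"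
      using \<gamma> arc_length_param_dist[OF \<gamma>(1)]
      by (intro exI[of _ \<gamma>] exI[of _ l]) (auto simp: arc_length_param_def)
  qed (use assms op C0 in auto)
  obtain C where C: "0 < C" and le: "\<And>f. nice f \<Longrightarrow>
    gagliardo_full \<Omega> s p \<alpha> \<beta> f \<le> ennreal C * gagliardo_truncated \<Omega> (2 * (\<theta> / 2)) s p \<alpha> \<beta> f"
    using full_le_truncated[OF admissibleI[OF assms(9,10)] admissibleI[OF assms(11,12)], of s] by auto
  have "gagliardo_full \<Omega> s p \<alpha> \<beta> f \<le> ennreal C * gagliardo_truncated \<Omega> \<theta> s p \<alpha> \<beta> f" if f: "L1_loc \<Omega> f" for f
  proof -
    obtain g where g: "nice g" and ae: "AE x in lborel. x \<in> \<Omega> \<longrightarrow> f x = g x"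
      using L1_loc_nice[OF f] .
    show ?thesis
      using le[OF g] gagliardo_full_cong_AE[OF ae, of s \<alpha> \<beta>]
        gagliardo_truncated_cong_AE[OF ae assms(8), of s \<alpha> \<beta>] by simp
  qed
  then show ?thesis using C by blast
qed

end
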